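(* (a) Let $\operatorname{Intermed}$ be the multivalued mapping with domain $\{f:[0,1]\to[-1,+1]\text{ continuous}: f(0)=-1,\ f(1)=1\}\subseteq C[0,1]$ defined by $\operatorname{Intermed}(f):=f^{-1}[\{0\}]$. Then $\mathfrak{C}_{\rm c}(\operatorname{Intermed},[\rho\to\rho],\rho)=\mathfrak{C}_{\rm t}(\operatorname{Intermed})=\omega$ (countably infinite). (b) Let $\operatorname{Select}$ be the multivalued mapping with domain $\{[a,b]:0\le a<b\le1\}$ (closed non-degenerate subintervals of $[0,1]$) defined by $\operatorname{Select}([a,b]):=[a,b]$. Then for no $d\in\mathbb{N}$ is $\operatorname{Select}$ $d$-wise $(\psi_>,\rho)$-continuous.
   Context: $\rho$ is the Cauchy representation of $\mathbb{R}$ (names encode rationals $q_k$ with $|x-q_k|\le2^{-k}$). $[\rho\to\rho]$ is the standard (Weihrauch) representation of the continuous real functions on $[0,1]$; $C[0,1]$ carries the supremum-norm topology. $\psi_>$ is the representation of nonempty closed subsets $B\subseteq\mathbb{R}$ by negative information: a name of $B$ encodes an enumeration of rational open intervals whose union is $\mathbb{R}\setminus B$ (equivalently, a name allows approximating the distance function $d_B$ from below). For a multivalued $f:\subseteq X\rightrightarrows Y$ ($\operatorname{dom}(f)=\{x:f(x)\ne\emptyset\}$): $f$ is continuous at $x$ if there is $y\in f(x)$ such that for every open $V\ni y$ there is a neighbourhood $U$ of $x$ with $f(z)\cap V\ne\emptyset$ for all $z\in U\cap\operatorname{dom}(f)$; continuous if so at every point of its domain. $\mathfrak{C}_{\rm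 t}(f)$ = least cardinality of a partition $\Delta$ of $\operatorname{dom}(f)$ with each $f|_D$ continuous. $\mathfrak{C}_{\rm c}(f,\alpha,\beta)$ = least cardinality $k$ of an at most countable partition $\Delta$ of $\operatorname{dom}(f)$ with a notation $\delta$ of $\Delta$ such that a Type-2 machine, given an $\alpha$-name of $a$ and a $\delta$-name of the part $D\ni a$, outputs a $\beta$-name of some element of $f(a)$. A multivalued $g$ is $(\alpha,\beta)$-continuous if there is a continuous $F:\subseteq\{0,1\}^\omega\to\{0,1\}^\omega$ mapping every $\alpha$-name of every $a\in\operatorname{dom}(g)$ to a $\beta$-name of some element of $g(a)$; $g$ is $d$-wise $(\alpha,\beta)$-continuous if $\operatorname{dom}(g)$ has a partition into $d$ sets $D$ with each $g|_D$ $(\alpha,\beta)$-continuous. *)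

theory Defs
  imports "HOL-Analysis.Analysis" "HOL-Library.Countable" "HOL-Library.Disjoint_Sets"
    "HOL-Library.Nat_Bijection"
begin

unbundle cardinal_syntax

section \<open>Multivalued mappings and topological complexity\<close>

text \<open>A multivalued mapping is a set-valued function; points outside its domain have an
  empty image.\<close>

definition mdom :: "('a \<Rightarrow> 'b set) \<Rightarrow> 'a set" where
  "mdom f = {x. f x \<noteq> {}}"

definition mrestrict :: "('a \<Rightarrow> 'b set) \<Rightarrow> 'a set \<Rightarrow> 'a \<Rightarrow> 'b set" where
  "mrestrict f D = (\<lambda>x. if x \<in> D then f x else {})"

definition mcontinuous_at :: "'a topology \<Rightarrow> 'b topology \<Rightarrow> ('a \<Rightarrow> 'b set) \<Rightarrow> 'a \<Rightarrow> bool" where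
  "mcontinuous_at X Y f x \<longleftrightarrow>
     (\<exists>y\<in>f x. \<forall>V. openin Y V \<and> y \<in> V \<longrightarrow>
        (\<exists>U. openin X U \<and> x \<in> U \<and> (\<forall>z\<in>U \<inter> mdom f. f z \<inter> V \<noteq> {})))"

definition mcontinuous :: "'a topology \<Rightarrow> 'b topology \<Rightarrow> ('a \<Rightarrow> 'b set) \<Rightarrow> bool" where
  "mcontinuous X Y f \<longleftrightarrow> (\<forall>x\<in>mdom f. mcontinuous_at X Y f x)"

text \<open>\<open>\<kappa>\<close> is the least cardinality of a member of \<open>\<D>\<close>. Cardinals are represented, as in the
  library, by well-order relations up to \<open>=o\<close>; \<^const>\<open>natLeq\<close> is \<open>\<omega>\<close>.\<close>

definition least_cardinality :: "'a set set \<Rightarrow> 'k rel \<Rightarrow> bool" where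
  "least_cardinality \<D> \<kappa> \<longleftrightarrow> (\<exists>\<Delta>\<in>\<D>. |\<Delta>| =o \<kappa>) \<and> (\<forall>\<Delta>\<in>\<D>. \<kappa> \<le>o |\<Delta>| )"

text \<open>\<open>C_t_eq X Y f \<kappa>\<close> reads: the topological complexity of \<open>f\<close> equals \<open>\<kappa>\<close>.\<close>

definition C_t_eq :: "'a topology \<Rightarrow> 'b topology \<Rightarrow> ('a \<Rightarrow> 'b set) \<Rightarrow> 'k rel \<Rightarrow> bool" where
  "C_t_eq X Y f \<kappa> \<longleftrightarrow>
     least_cardinality
       {\<Delta>. partition_on (mdom f) \<Delta> \<and> (\<forall>D\<in>\<Delta>. mcontinuous X Y (mrestrict f D))} \<kappa>"


section \<open>Type-2 machines\<close>

text \<open>A Type-2 machine is a Turing machine with one-way read-only input tapes, two-way infinite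
  work tapes and a one-way write-only output tape, given by a finite program. Since the program
  is finite, only finitely many tapes are used. \<^term>\<open>None\<close> is the blank. The two
  \<open>Branch\<close> instructions jump to the given address if the scanned symbol is the given one and
  continue with the next instruction otherwise; the machine halts when the program counter leaves
  the program.\<close>

type_synonym symbol = "bool option"

datatype instr =
    InRight nat
  | InBranch nat symbol nat
  | WorkLeft nat
  | WorkRight nat
  | WorkWrite nat symbol
  | WorkBranch nat symbol nat
  | Goto nat
  | Out bool

type_synonym machine = "instr list"

record config =
  pc :: nat
  in_pos :: "nat \<Rightarrow> nat"
  work_pos :: "nat \<Rightarrow> int"
  work :: "nat \<Rightarrow> int \<Rightarrow> symbol"
  written :: "bool list"

definition init_config :: config where
  "init_config = \<lparr>pc = 0, in_pos = (\<lambda>_. 0), work_pos = (\<lambda>_. 0), work = (\<lambda>_ _. None), written = []\<rparr>"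

fun exec :: "(nat \<Rightarrow> nat \<Rightarrow> symbol) \<Rightarrow> instr \<Rightarrow> config \<Rightarrow> config" where
  "exec I (InRight i) c = c\<lparr>pc := Suc (pc c), in_pos := (in_pos c)(i := Suc (in_pos c i))\<rparr>"
| "exec I (InBranch i a l) c = c\<lparr>pc := (if I i (in_pos c i) = a then l else Suc (pc c))\<rparr>"
| "exec I (WorkLeft j) c = c\<lparr>pc := Suc (pc c), work_pos := (work_pos c)(j := work_pos c j - 1)\<rparr>"
| "exec I (WorkRight j) c = c\<lparr>pc := Suc (pc c), work_pos := (work_pos c)(j := work_pos c j + 1)\<rparr>"
| "exec I (WorkWrite j a) c =
     c\<lparr>pc := Suc (pc c), work := (work c)(j := (work c j)(work_pos c j := a))\<rparr>"
| "exec I (WorkBranch j a l) c =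
     c\<lparr>pc := (if work c j (work_pos c j) = a then l else Suc (pc c))\<rparr>"
| "exec I (Goto l) c = c\<lparr>pc := l\<rparr>"
| "exec I (Out b) c = c\<lparr>pc := Suc (pc c), written := written c @ [b]\<rparr>"

definition step :: "machine \<Rightarrow> (nat \<Rightarrow> nat \<Rightarrow> symbol) \<Rightarrow> config \<Rightarrow> config" where
  "step M I c = (if pc c < length M then exec I (M ! pc c) c else c)"

definition run :: "machine \<Rightarrow> (nat \<Rightarrow> nat \<Rightarrow> symbol) \<Rightarrow> nat \<Rightarrow> config" where
  "run M I t = (step M I ^^ t) init_config"

text \<open>The machine never stops writing, and the sequence it writes is \<open>q\<close>.\<close>

definition writes :: "machine \<Rightarrow> (nat \<Rightarrow> nat \<Rightarrow> symbol) \<Rightarrow> (nat \<Rightarrow> bool) \<Rightarrow> bool" where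
  "writes M I q \<longleftrightarrow>
     (\<forall>t. written (run M I t) = map q [0..<length (written (run M I t))]) \<and>
     (\<forall>n. \<exists>t. n \<le> length (written (run M I t)))"

text \<open>Input tape 0 holds the infinite sequence \<open>p\<close>, input tape 1 the finite word \<open>w\<close>.\<close>

definition inputs :: "(nat \<Rightarrow> bool) \<Rightarrow> bool list \<Rightarrow> nat \<Rightarrow> nat \<Rightarrow> symbol" where
  "inputs p w i n =
     (if i = 0 then Some (p n)
      else if i = 1 \<and> n < length w then Some (w ! n)
      else None)"


section \<open>Representations and computational complexity\<close>

text \<open>A representation is given by the relation ``\<open>p\<close> is a name of \<open>x\<close>''.\<close>

type_synonym 'a representation = "(nat \<Rightarrow> bool) \<Rightarrow> 'a \<Rightarrow> bool"

text \<open>A notation of \<open>\<Delta>\<close> is a partial map from finite words onto \<open>\<Delta>\<close>.\<close>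

definition notation_of :: "'a set \<Rightarrow> (bool list \<Rightarrow> 'a option) \<Rightarrow> bool" where
  "notation_of \<Delta> \<delta> \<longleftrightarrow> ran \<delta> = \<Delta>"

definition computable_with_advice ::
  "('a \<Rightarrow> 'b set) \<Rightarrow> 'a representation \<Rightarrow> 'b representation \<Rightarrow>
   (bool list \<Rightarrow> 'a set option) \<Rightarrow> bool" where
  "computable_with_advice f \<alpha> \<beta> \<delta> \<longleftrightarrow>
     (\<exists>M. \<forall>a\<in>mdom f. \<forall>p w D. \<alpha> p a \<and> \<delta> w = Some D \<and> a \<in> D \<longrightarrow>
        (\<exists>q. writes M (inputs p w) q \<and> (\<exists>b\<in>f a. \<beta> q b)))"

text \<open>\<open>C_c_eq f \<alpha> \<beta> \<kappa>\<close> reads: the complexity of nonuniform computability of \<open>f\<close> equals \<open>\<kappa>\<close>.\<close>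

definition C_c_eq ::
  "('a \<Rightarrow> 'b set) \<Rightarrow> 'a representation \<Rightarrow> 'b representation \<Rightarrow> 'k rel \<Rightarrow> bool" where
  "C_c_eq f \<alpha> \<beta> \<kappa> \<longleftrightarrow>
     least_cardinality
       {\<Delta>. partition_on (mdom f) \<Delta> \<and> countable \<Delta> \<and>
          (\<exists>\<delta>. notation_of \<Delta> \<delta> \<and> computable_with_advice f \<alpha> \<beta> \<delta>)} \<kappa>"

text \<open>Continuity of the realizer refers to the product topology on infinite binary sequences.\<close>

definition rep_continuous ::
  "'a representation \<Rightarrow> 'b representation \<Rightarrow> ('a \<Rightarrow> 'b set) \<Rightarrow> bool" where
  "rep_continuous \<alpha> \<beta> g \<longleftrightarrow>
     (\<exists>S (F :: (nat \<Rightarrow> bool) \<Rightarrow> (nat \<Rightarrow> bool)). continuous_on S F \<and>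
        (\<forall>a\<in>mdom g. \<forall>p. \<alpha> p a \<longrightarrow> p \<in> S \<and> (\<exists>b\<in>g a. \<beta> (F p) b)))"

definition wise_rep_continuous ::
  "nat \<Rightarrow> 'a representation \<Rightarrow> 'b representation \<Rightarrow> ('a \<Rightarrow> 'b set) \<Rightarrow> bool" where
  "wise_rep_continuous d \<alpha> \<beta> g \<longleftrightarrow>
     (\<exists>\<Delta>. partition_on (mdom g) \<Delta> \<and> finite \<Delta> \<and> card \<Delta> = d \<and>
        (\<forall>D\<in>\<Delta>. rep_continuous \<alpha> \<beta> (mrestrict g D)))"


section \<open>The representations of reals, continuous functions and closed sets\<close>

text \<open>A sequence \<open>s\<close> of natural numbers is encoded by the binary sequence consisting of \<open>s 0\<close> ones,
  a zero, \<open>s 1\<close> ones, a zero, and so on: the \<open>k\<close>-th zero is at position \<open>s 0 + \<dots> + s k + k\<close>.\<close>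

definition unary :: "(nat \<Rightarrow> nat) \<Rightarrow> nat \<Rightarrow> bool" where
  "unary s i \<longleftrightarrow> i \<notin> range (\<lambda>k. (\<Sum>j\<le>k. s j) + k)"

definition rat_num :: "nat \<Rightarrow> real" where
  "rat_num n = of_rat (nat_to_rat_surj n)"

definition rho :: "real representation" where
  "rho p x \<longleftrightarrow> (\<exists>s. p = unary s \<and> (\<forall>k. \<bar>x - rat_num (s k)\<bar> \<le> 1 / 2 ^ k))"

text \<open>The number of a finite word, with the first letter as least significant bit and a leading 1
  marking the end.\<close>

fun word_num :: "bool list \<Rightarrow> nat" where
  "word_num [] = 1"
| "word_num (b # w) = of_bool b + 2 * word_num w"

definition prefix_of :: "bool list \<Rightarrow> (nat \<Rightarrow> bool) \<Rightarrow> bool" where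
  "prefix_of u q \<longleftrightarrow> u = map q [0..<length u]"

text \<open>Standard representation of the continuous partial functions on infinite binary sequences
  (with \<open>G\<^sub>\<delta>\<close> domain): a name \<open>p\<close> of such a function lists pairs \<open>(u, v)\<close> of words, meaning
  that every argument starting with \<open>u\<close> has a value starting with \<open>v\<close>; numbers that are not codes
  of pairs are ignored. \<open>eta p q r\<close> reads: the function named by \<open>p\<close> maps \<open>q\<close> to \<open>r\<close>; it is
  undefined at \<open>q\<close> if the listed words \<open>v\<close> contradict each other or have bounded length.\<close>

definition listed :: "(nat \<Rightarrow> nat) \<Rightarrow> bool list \<Rightarrow> bool list \<Rightarrow> bool" where
  "listed s u v \<longleftrightarrow> (\<exists>k. s k = prod_encode (word_num u, word_num v))"

definition eta :: "(nat \<Rightarrow> bool) \<Rightarrow> (nat \<Rightarrow> bool) \<Rightarrow> (nat \<Rightarrow> bool) \<Rightarrow> bool" where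
  "eta p q r \<longleftrightarrow>
     (\<exists>s. p = unary s \<and>
        (\<forall>u v. listed s u v \<and> prefix_of u q \<longrightarrow> prefix_of v r) \<and>
        (\<forall>n. \<exists>u v. listed s u v \<and> prefix_of u q \<and> n \<le> length v))"

text \<open>\<open>C[0,1]\<close> with the supremum metric; its points are extensional functions on \<open>[0,1]\<close>.\<close>

definition C01 :: "(real \<Rightarrow> real) metric" where
  "C01 = cfunspace (top_of_set {0..1}) euclidean_metric"

text \<open>A \<open>[\<rho>\<rightarrow>\<rho>]\<close>-name of \<open>f\<close> is a name of a continuous function on sequences that maps every
  \<open>\<rho>\<close>-name of every \<open>x \<in> [0,1]\<close> to a \<open>\<rho>\<close>-name of \<open>f x\<close>.\<close>

definition rho_to_rho :: "(real \<Rightarrow> real) representation" where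
  "rho_to_rho p f \<longleftrightarrow> f \<in> mspace C01 \<and>
     (\<forall>x\<in>{0..1}. \<forall>q. rho q x \<longrightarrow> (\<exists>r. eta p q r \<and> rho r (f x)))"

text \<open>Intervals \<open>{a<..<b}\<close> with \<open>b \<le> a\<close> are empty, so that also the empty complement of the whole
  line can be enumerated. A set with a name is closed, its complement being a union of open
  intervals.\<close>

definition psi_gt :: "real set representation" where
  "psi_gt p B \<longleftrightarrow> B \<noteq> {} \<and>
     (\<exists>s. p = unary s \<and>
        (\<Union>k. case prod_decode (s k) of (i, j) \<Rightarrow> {rat_num i<..<rat_num j}) = - B)"


section \<open>The two multivalued mappings\<close>

definition Intermed :: "(real \<Rightarrow> real) \<Rightarrow> real set" where
  "Intermed f =
     (if f \<in> mspace C01 \<and> f ` {0..1} \<subseteq> {-1..1} \<and> f 0 = -1 \<and> f 1 = 1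
      then {x\<in>{0..1}. f x = 0} else {})"

definition Select :: "real set \<Rightarrow> real set" where
  "Select B = (if \<exists>a b. 0 \<le> a \<and> a < b \<and> b \<le> 1 \<and> B = {a..b} then B else {})"

end

theory Submission
  imports Defs
begin

text \<open>Lower bounds. If \<open>f\<close> vanishes exactly on \<open>[a, b]\<close> and the zero \<open>y\<close> is approximated by zeros of
  all nearby members of a part \<open>D\<close>, then a small perturbation of \<open>f\<close> whose zero set is a subinterval
  away from \<open>y\<close> has a neighbourhood that misses \<open>D\<close>. Repeating this for the finitely many parts
  leaves an open set that misses all of them. Select is treated in the same way, with finite parts
  of names in place of neighbourhoods. A machine that works on a part \<open>D\<close> makes the restriction to
  \<open>D\<close> continuous, because \<open>f\<close> has a name every finite part of which extends to names of all
  functions near \<open>f\<close>; so the bound carries over to computability with advice.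

  Upper bound. The advice is either a rational zero of \<open>f\<close> or the information that there is none.
  In the latter case bisection succeeds, because the signs of \<open>f\<close> at all dyadic numbers are
  eventually revealed. A pair listed in the name of \<open>f\<close> reveals the sign at the current midpoint if
  its first word is a prefix of the constant name of the midpoint and its second word contains a
  sufficiently precise approximation of the value; infinitely many listed pairs do, so
  the name need not be remembered.\<close>

section \<open>Names as sequences of blocks\<close>

text \<open>The lower bound can be iterated because the perturbation is quantitative. Mixing
  \<open>f\<close> with a small multiple \<open>e\<close> of a piecewise linear function stays close
  to \<open>f\<close> and forces a gap \<open>e * d\<close> at all points near \<open>y\<close>, so
  a whole ball of functions has no zero there. The new function again vanishes on a nondegenerate
  interval, which leaves room to treat the next part inside that ball.

  Advice is needed because a sign test at a zero never terminates: bisection gets stuck if a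
  midpoint is a zero. Naming a rational zero costs countably many parts, and excluding all of them
  makes every midpoint test terminate.

  The obstacle in the upper bound is that machines are concrete programs with one-way input, so an
  explicit program has to be exhibited. It comes from a register language in which primitive
  recursion and bounded quantifiers can be composed; besides the advice, only two numbers are
  carried from one block of the name to the next. Efficiency is irrelevant, so registers may be
  unary.\<close>

fun enc :: "nat list \<Rightarrow> bool list" where
  "enc [] = []"
| "enc (a # as) = replicate a True @ False # enc as"

lemma enc_append: "enc (as @ bs) = enc as @ enc bs"
  by (induction as) auto

lemma length_le_length_enc: "length as \<le> length (enc as)"
  by (induction as) auto

lemma prefix_of_iff: "prefix_of u q \<longleftrightarrow> (\<forall>i<length u. u ! i = q i)"
  unfolding prefix_of_def by (subst list_eq_iff_nth_eq) simp

lemma prefix_of_Nil [simp]: "prefix_of [] q"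
  by (simp add: prefix_of_def)

lemma prefix_of_append:
  "prefix_of (u @ v) q \<longleftrightarrow> prefix_of u q \<and> prefix_of v (\<lambda>i. q (length u + i))"
proof -
  have split: "(\<forall>i<m + n. P i) \<longleftrightarrow> (\<forall>i<m. P i) \<and> (\<forall>i<n. P (m + i))" for m n :: nat and P
  proof safe
    fix i
    assume "\<forall>i<m. P i" "\<forall>i<n. P (m + i)" "i < m + n"
    then show "P i"
      by (cases "i < m") (auto dest!: spec[of _ "i - m"])
  qed auto
  show ?thesis
    by (simp add: prefix_of_iff split nth_append)
qed

lemma prefix_of_Cons: "prefix_of (b # v) q \<longleftrightarrow> b = q 0 \<and> prefix_of v (\<lambda>i. q (Suc i))"
  using prefix_of_append[of "[b]" v q] by (auto simp: prefix_of_iff)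

lemma unary_less:
  assumes "i < s 0"
  shows "unary s i"
proof -
  have "i \<noteq> (\<Sum>j\<le>k. s j) + k" for k
    using member_le_sum[of 0 "{..k}" s] assms by simp
  then show ?thesis
    by (auto simp: unary_def)
qed

lemma unary_first_zero: "\<not> unary s (s 0)"
  unfolding unary_def by (auto intro!: image_eqI[of _ _ 0])

text \<open>Cutting off the first block; all inductions over blocks use this equation.\<close>

lemma unary_shift: "unary s (Suc (s 0) + i) = unary (\<lambda>k. s (Suc k)) i"
proof -
  have "Suc (s 0) + i \<in> range (\<lambda>k. (\<Sum>j\<le>k. s j) + k) \<longleftrightarrow>
      (\<exists>k. Suc (s 0) + i = (\<Sum>j\<le>Suc k. s j) + Suc k)"
    unfolding image_iff
  proof safe
    fix k assume "Suc (s 0) + i = (\<Sum>j\<le>k. s j) + k"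
    then show "\<exists>k. Suc (s 0) + i = (\<Sum>j\<le>Suc k. s j) + Suc k"
      by (cases k) auto
  qed blast
  also have "\<dots> \<longleftrightarrow> i \<in> range (\<lambda>k. (\<Sum>j\<le>k. s (Suc j)) + k)"
    by (auto simp: sum.atMost_Suc_shift simp del: sum.atMost_Suc)
  finally show ?thesis
    by (simp add: unary_def)
qed

text \<open>The code is self-delimiting: a zero ends each block, so a prefix made of complete blocks
  can be parsed in only one way.\<close>

lemma prefix_of_enc_unary:
  "prefix_of (enc as) (unary s) \<longleftrightarrow> as = map s [0..<length as]"
proof (induction as arbitrary: s)
  case (Cons a as)
  have a: "prefix_of (replicate a True) (unary s) \<and> \<not> unary s a \<longleftrightarrow> a = s 0"
    by (metis length_replicate linorder_neqE_nat nth_replicate prefix_of_iff unary_first_zero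
        unary_less)
  have "prefix_of (enc (a # as)) (unary s) \<longleftrightarrow>
      a = s 0 \<and> prefix_of (enc as) (\<lambda>i. unary s (Suc (s 0) + i))"
    using a by (auto simp: prefix_of_append prefix_of_Cons)
  also have "\<dots> \<longleftrightarrow> a # as = map s [0..<length (a # as)]"
    by (simp only: unary_shift Cons.IH) (simp add: map_upt_Suc del: upt_Suc)
  finally show ?case .
qed simp

lemma prefix_of_enc_map [simp]: "prefix_of (enc (map s [0..<n])) (unary s)"
  by (simp add: prefix_of_enc_unary)

text \<open>Every block occupies at least one position, so \<open>n\<close> blocks cover the first
  \<open>n\<close> positions.\<close>

lemma unary_eq_upto:
  assumes "\<forall>k<n. s k = s' k" "i < n"
  shows "unary s i = unary s' i"
proof -
  have "map s [0..<n] = map s' [0..<n]"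
    using assms by auto
  then have "prefix_of (enc (map s [0..<n])) (unary s')"
    using prefix_of_enc_map[of s' n] by metis
  moreover have "i < length (enc (map s [0..<n]))"
    using assms(2) length_le_length_enc[of "map s [0..<n]"] by simp
  ultimately show ?thesis
    using prefix_of_enc_map[of s n] unfolding prefix_of_iff by metis
qed

text \<open>The converse transfer, from positions to blocks. The number of positions to compare
  depends on \<open>s\<close>, because blocks may be arbitrarily long.\<close>

lemma unary_determines:
  assumes "\<forall>i<length (enc (map s [0..<n])). unary s i = unary s' i" "k < n"
  shows "s k = s' k"
proof -
  have "prefix_of (enc (map s [0..<n])) (unary s')"
    using assms(1) prefix_of_enc_map[of s n] by (simp add: prefix_of_iff)
  then have "map s [0..<n] = map s' [0..<n]"
    by (simp add: prefix_of_enc_unary)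
  then show ?thesis
    using assms(2) by simp
qed

lemma unary_inject [simp]: "unary s = unary s' \<longleftrightarrow> s = s'"
  using unary_determines[of s _ s'] by (metis ext lessI)

lemma rat_num_surj: "x \<in> \<rat> \<Longrightarrow> \<exists>n. rat_num n = x"
  unfolding rat_num_def using Rats_eq_range_of_rat_o_nat_to_rat_surj
  by (metis comp_apply imageE)

lemma rat_num_between:
  assumes "a < b"
  shows "\<exists>n. a < rat_num n \<and> rat_num n < b"
proof -
  obtain r where "a < of_rat r" "of_rat r < b"
    using of_rat_dense[OF assms] by auto
  moreover obtain n where "rat_num n = of_rat r"
    using rat_num_surj[of "of_rat r"] by auto
  ultimately show ?thesis
    by (intro exI[of _ n]) simp
qed

lemma rat_num_approx:
  assumes "0 < e"
  shows "\<exists>n. \<bar>x - rat_num n\<bar> < e"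
proof -
  obtain n where "x - e < rat_num n" "rat_num n < x"
    using rat_num_between[of "x - e" x] assms by auto
  then show ?thesis
    by (intro exI[of _ n]) simp
qed

lemma rho_unary: "rho (unary s) x \<longleftrightarrow> (\<forall>k. \<bar>x - rat_num (s k)\<bar> \<le> 1 / 2 ^ k)"
  by (simp add: rho_def)

text \<open>Agreement in a single block of index \<open>k\<close> bounds the distance of the named
  points by \<open>2 / 2 ^ k\<close>.\<close>

lemma rho_modulus:
  assumes "rho q y" "0 < e"
  shows "\<exists>n. \<forall>q' y'. rho q' y' \<and> (\<forall>i<n. q i = q' i) \<longrightarrow> \<bar>y' - y\<bar> < e"
proof -
  obtain s where s: "q = unary s" "\<And>k. \<bar>y - rat_num (s k)\<bar> \<le> 1 / 2 ^ k"
    using assms(1) unfolding rho_def by blast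
  obtain k where k: "(1 / 2) ^ k < e / 2"
    using real_arch_pow_inv[of "e / 2" "1 / 2"] assms(2) by auto
  have "\<bar>y' - y\<bar> < e"
    if "rho q' y'" and eq: "\<forall>i<length (enc (map s [0..<Suc k])). q i = q' i" for q' y'
  proof -
    obtain s' where s': "q' = unary s'" "\<And>k. \<bar>y' - rat_num (s' k)\<bar> \<le> 1 / 2 ^ k"
      using \<open>rho q' y'\<close> unfolding rho_def by blast
    have "s k = s' k"
      using unary_determines[of s "Suc k" s' k] eq s(1) s'(1) by simp
    then show ?thesis
      using s(2)[of k] s'(2)[of k] k by (simp add: power_one_over)
  qed
  then show ?thesis
    by blast
qed

section \<open>Names of nearby continuous functions\<close>

text \<open>The boundedness required by \<open>cfunspace\<close> is automatic, since the unit
  interval is compact.\<close>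

lemma mspace_C01: "f \<in> mspace C01 \<longleftrightarrow> continuous_on {0..1} f \<and> f \<in> extensional {0..1}"
proof -
  have "bounded (f ` {0..1})" if "continuous_on {0..1} f" for f :: "real \<Rightarrow> real"
    by (intro compact_imp_bounded compact_continuous_image that) simp
  moreover have "Metric_space.mbounded (UNIV :: real set) dist S \<longleftrightarrow> bounded S" for S
    by simp
  ultimately show ?thesis
    unfolding C01_def by (auto simp: continuous_map_iff_continuous)
qed

lemma C01_dist_le: "f \<in> mspace C01 \<Longrightarrow> g \<in> mspace C01 \<Longrightarrow>
  mdist C01 f g \<le> e \<longleftrightarrow> (\<forall>x\<in>{0..1}. \<bar>f x - g x\<bar> \<le> e)"
  unfolding C01_def by (subst cfunspace_mdist_le) (auto simp: dist_real_def)

lemma C01_dist_pointwise: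
  "f \<in> mspace C01 \<Longrightarrow> g \<in> mspace C01 \<Longrightarrow> x \<in> {0..1} \<Longrightarrow> \<bar>f x - g x\<bar> \<le> mdist C01 f g"
  using C01_dist_le[of f g "mdist C01 f g"] by auto

lemma openin_C01D:
  assumes "openin (mtopology_of C01) U" "f \<in> U"
  shows "\<exists>r>0. \<forall>g\<in>mspace C01. mdist C01 f g < r \<longrightarrow> g \<in> U"
proof -
  interpret Metric_space "mspace C01" "mdist C01"
    by (rule Metric_space_mspace_mdist)
  obtain r where "0 < r" "mball f r \<subseteq> U" "f \<in> mspace C01"
    using assms unfolding mtopology_of_def openin_mtopology by blast
  then show ?thesis
    by (metis in_mball subsetD)
qed

lemma openin_C01_ball:
  "f \<in> mspace C01 \<Longrightarrow> openin (mtopology_of C01) {g \<in> mspace C01. mdist C01 f g < r}"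
proof -
  interpret Metric_space "mspace C01" "mdist C01"
    by (rule Metric_space_mspace_mdist)
  assume "f \<in> mspace C01"
  then have "{g \<in> mspace C01. mdist C01 f g < r} = mball f r"
    by auto
  then show ?thesis
    unfolding mtopology_of_def by simp
qed

lemma C01_dist_self: "f \<in> mspace C01 \<Longrightarrow> mdist C01 f f = 0"
  by simp

section \<open>Word numbers and tabulated names of continuous functions\<close>

lemma word_num_pos [simp]: "0 < word_num u"
  by (induction u) auto

lemma word_num_nonzero [simp]: "word_num u \<noteq> 0"
  using word_num_pos[of u] by linarith

lemma word_num_inject [simp]: "word_num u = word_num v \<longleftrightarrow> u = v"
proof
  show "word_num u = word_num v \<Longrightarrow> u = v"
  proof (induction u arbitrary: v)
    case Nil
    then show ?case
      by (cases v) (auto simp: of_bool_def split: if_splits)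
  next
    case (Cons b u)
    then show ?case
    proof (cases v)
      case Nil
      then show ?thesis
        using Cons.prems word_num_pos[of u] by (cases b; simp)
    next
      case (Cons b' v')
      have "of_bool b = (of_bool b' :: nat) \<and> word_num u = word_num v'"
        using Cons.prems Cons by (auto simp: of_bool_def split: if_splits) presburger+
      then show ?thesis
        using Cons.IH Cons by (auto simp: of_bool_def split: if_splits)
    qed
  qed
qed simp

text \<open>Names of \<open>f\<close> of a special form: \<open>m\<close> is a modulus of continuity, and \<open>T j a\<close> is the number
  of an approximation to \<open>f x\<close> with error \<open>1 / 2 ^ j\<close> for all \<open>x\<close> at distance at most
  \<open>1 / 2 ^ m j\<close> from the rational number with number \<open>a\<close>. Since 0 is not the code of a pair of
  words, it serves as a dummy entry.\<close>

definition tabulates :: "(nat \<Rightarrow> nat) \<Rightarrow> (nat \<Rightarrow> nat \<Rightarrow> nat) \<Rightarrow> nat \<Rightarrow> real \<Rightarrow> (real \<Rightarrow> real) \<Rightarrow> bool"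
  where "tabulates m T j e f \<longleftrightarrow>
    (\<forall>a. \<forall>x\<in>{0..1}. \<bar>x - rat_num a\<bar> \<le> 1 / 2 ^ m j \<longrightarrow> \<bar>f x - rat_num (T j a)\<bar> \<le> e)"

fun table_entry :: "(nat \<Rightarrow> nat) \<Rightarrow> (nat \<Rightarrow> nat \<Rightarrow> nat) \<Rightarrow> nat \<times> nat list \<Rightarrow> nat" where
  "table_entry m T (k, as) =
     (if \<forall>j\<le>k. m j < length as
      then prod_encode (word_num (enc as), word_num (enc (map (\<lambda>j. T j (as ! m j)) [0..<Suc k])))
      else 0)"

text \<open>\<open>from_nat\<close> runs through all pairs \<open>(k, as)\<close>, so every finite
  list of argument blocks eventually receives its line.\<close>

definition table :: "(nat \<Rightarrow> nat) \<Rightarrow> (nat \<Rightarrow> nat \<Rightarrow> nat) \<Rightarrow> nat \<Rightarrow> nat" where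
  "table m T i = table_entry m T (from_nat i)"

lemma listed_table:
  "listed (table m T) u v \<longleftrightarrow> (\<exists>k as. (\<forall>j\<le>k. m j < length as) \<and> u = enc as \<and>
     v = enc (map (\<lambda>j. T j (as ! m j)) [0..<Suc k]))" (is "?l \<longleftrightarrow> ?r")
proof
  have nz: "prod_encode (word_num u, word_num v) \<noteq> 0"
    using word_num_pos[of u] le_prod_encode_1[of "word_num u" "word_num v"] by linarith
  assume ?l
  then obtain i where i: "table m T i = prod_encode (word_num u, word_num v)"
    by (auto simp: listed_def)
  obtain k as where kas: "(from_nat i :: nat \<times> nat list) = (k, as)"
    by (rule prod.exhaust)
  show ?r
    using i nz by (auto simp: table_def kas split: if_splits simp del: upt_Suc)
next
  assume ?r
  then obtain k as where "\<forall>j\<le>k. m j < length as" "u = enc as"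
      "v = enc (map (\<lambda>j. T j (as ! m j)) [0..<Suc k])"
    by blast
  then have "table m T (to_nat (k, as)) = prod_encode (word_num u, word_num v)"
    by (simp add: table_def del: upt_Suc)
  then show ?l
    by (auto simp: listed_def)
qed

text \<open>Output block \<open>j\<close> depends on block \<open>m j\<close> of the argument alone.
  Hence lines for different prefixes of one argument never contradict each other, and longer
  prefixes yield longer outputs.\<close>

lemma eta_table: "eta (unary (table m T)) (unary s) (unary (\<lambda>j. T j (s (m j))))"
proof -
  have "prefix_of v (unary (\<lambda>j. T j (s (m j))))"
    if uv: "listed (table m T) u v" "prefix_of u (unary s)" for u v
  proof -
    obtain k as where k: "\<forall>j\<le>k. m j < length as" "u = enc as"
        "v = enc (map (\<lambda>j. T j (as ! m j)) [0..<Suc k])"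
      using uv(1) unfolding listed_table by (elim exE conjE) (rule that)
    have as: "as = map s [0..<length as]"
      using uv(2) k(2) prefix_of_enc_unary by simp
    have "as ! m j = s (m j)" if "j \<le> k" for j
      using k(1) that by (subst as) simp
    then have "v = enc (map (\<lambda>j. T j (s (m j))) [0..<Suc k])"
      using k(3) by (auto simp del: upt_Suc intro!: arg_cong[where f = enc])
    then show ?thesis
      by (simp only: prefix_of_enc_map)
  qed
  moreover have "\<exists>u v. listed (table m T) u v \<and> prefix_of u (unary s) \<and> n \<le> length v" for n
  proof -
    define l where "l = Suc (\<Sum>j\<le>n. m j)"
    define as where "as = map s [0..<l]"
    have "m j < l" if "j \<le> n" for j
      unfolding l_def using member_le_sum[of j "{..n}" m] that by (simp add: less_Suc_eq_le)
    then have "listed (table m T) (enc as) (enc (map (\<lambda>j. T j (as ! m j)) [0..<Suc n]))"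
      unfolding listed_table by (intro exI[of _ n] exI[of _ as]) (auto simp: as_def)
    moreover have "prefix_of (enc as) (unary s)"
      unfolding as_def by (rule prefix_of_enc_map)
    moreover have "n \<le> length (enc (map (\<lambda>j. T j (as ! m j)) [0..<Suc n]))"
      by (rule order_trans[OF _ length_le_length_enc]) simp
    ultimately show ?thesis
      by blast
  qed
  ultimately show ?thesis
    unfolding eta_def by blast
qed

lemma rho_to_rho_table:
  assumes "f \<in> mspace C01" "\<And>j. tabulates m T j (1 / 2 ^ j) f"
  shows "rho_to_rho (unary (table m T)) f"
proof -
  have "\<exists>r. eta (unary (table m T)) q r \<and> rho r (f x)" if x: "x \<in> {0..1}" and q: "rho q x" for x q
  proof -
    obtain s where "q = unary s" "\<And>k. \<bar>x - rat_num (s k)\<bar> \<le> 1 / 2 ^ k"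
      using q unfolding rho_def by blast
    moreover have "rho (unary (\<lambda>j. T j (s (m j)))) (f x)"
      using assms(2) x calculation(2) by (auto simp: rho_unary tabulates_def)
    ultimately show ?thesis
      using eta_table by blast
  qed
  then show ?thesis
    using assms(1) by (simp add: rho_to_rho_def)
qed

lemma tabulates_exists:
  assumes "f \<in> mspace C01" "0 < e"
  shows "\<exists>k t. \<forall>a. \<forall>x\<in>{0..1}. \<bar>x - rat_num a\<bar> \<le> 1 / 2 ^ k \<longrightarrow> \<bar>f x - rat_num (t a)\<bar> \<le> e"
proof -
  have "uniformly_continuous_on {0..1} f"
    using assms(1) by (intro compact_uniformly_continuous) (simp_all add: mspace_C01)
  then obtain d where d: "0 < d"
      "\<And>x x'. x \<in> {0..1} \<Longrightarrow> x' \<in> {0..1} \<Longrightarrow> \<bar>x' - x\<bar> < d \<Longrightarrow> \<bar>f x' - f x\<bar> < e / 2"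
    unfolding uniformly_continuous_on_def dist_real_def using assms(2)
    by (metis half_gt_zero)
  \<comment> \<open>Two points with the same rational approximation are at most
    \<open>2 * (1 / 2) ^ k\<close> apart, which has to be less than \<open>d\<close>.\<close>
  obtain k where k: "(1 / 2) ^ k < d / 2"
    using real_arch_pow_inv[of "d / 2" "1 / 2"] d(1) by auto
  have "\<exists>n. \<forall>x\<in>{0..1}. \<bar>x - rat_num a\<bar> \<le> 1 / 2 ^ k \<longrightarrow> \<bar>f x - rat_num n\<bar> \<le> e" for a
  \<comment> \<open>A rational number far from the unit interval imposes no condition, so its entry
    is arbitrary.\<close>
  proof (cases "\<exists>z\<in>{0..1}. \<bar>z - rat_num a\<bar> \<le> 1 / 2 ^ k")
    case True
    then obtain z where z: "z \<in> {0..1}" "\<bar>z - rat_num a\<bar> \<le> 1 / 2 ^ k"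
      by blast
    obtain n where n: "\<bar>f z - rat_num n\<bar> < e / 2"
      using rat_num_approx[of "e / 2" "f z"] assms(2) by auto
    have "\<bar>f x - rat_num n\<bar> \<le> e" if "x \<in> {0..1}" "\<bar>x - rat_num a\<bar> \<le> 1 / 2 ^ k" for x
    proof -
      have "\<bar>x - z\<bar> < d"
        using z(2) that(2) k by (simp add: power_one_over)
      then have "\<bar>f x - f z\<bar> < e / 2"
        using d(2) z(1) that(1) by blast
      then show ?thesis
        using n by linarith
    qed
    then show ?thesis
      by blast
  qed blast
  then show ?thesis
    by metis
qed

text \<open>The table of \<open>f\<close> is chosen with half the permitted error, so that its first lines are also
  correct for all functions near \<open>f\<close>.\<close>

lemma rho_to_rho_name_open:
  assumes "f \<in> mspace C01"
  shows "\<exists>p. rho_to_rho p f \<and> (\<forall>n. \<exists>e>0. \<forall>g\<in>mspace C01. mdist C01 f g < e \<longrightarrow>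
           (\<exists>p'. rho_to_rho p' g \<and> (\<forall>i<n. p i = p' i)))"
proof -
  have ex: "\<forall>j. \<exists>k t. \<forall>a. \<forall>x\<in>{0..1}. \<bar>x - rat_num a\<bar> \<le> 1 / 2 ^ k \<longrightarrow>
      \<bar>g x - rat_num (t a)\<bar> \<le> 1 / 2 ^ j / 2" if "g \<in> mspace C01" for g
    using tabulates_exists[OF that] by simp
  obtain m T where mT: "\<And>j. tabulates m T j (1 / 2 ^ j / 2) f"
    using ex[OF assms] unfolding tabulates_def by metis
  have "\<exists>e>0. \<forall>g\<in>mspace C01. mdist C01 f g < e \<longrightarrow>
          (\<exists>p'. rho_to_rho p' g \<and> (\<forall>i<n. unary (table m T) i = p' i))" for n
  proof -
    \<comment> \<open>\<open>K\<close> bounds the first index of the pairs behind the first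
      \<open>n\<close> table lines. These lines cover the first \<open>n\<close> bits, so those bits
      involve \<open>m j\<close> and \<open>T j\<close> only for \<open>j \<le> K\<close>.\<close>
    define K where "K = (\<Sum>i<n. fst (from_nat i :: nat \<times> nat list))"
    have "\<exists>p'. rho_to_rho p' g \<and> (\<forall>i<n. unary (table m T) i = p' i)"
      if g: "g \<in> mspace C01" "mdist C01 f g < 1 / 2 ^ K / 2" for g
    proof -
      obtain m' T' where m'T': "\<And>j. tabulates m' T' j (1 / 2 ^ j / 2) g"
        using ex[OF g(1)] unfolding tabulates_def by metis
      \<comment> \<open>A hybrid table: up to precision \<open>K\<close> the one of
        \<open>f\<close>, whose slack absorbs the distance to \<open>g\<close>; beyond
        \<open>K\<close> the one of \<open>g\<close> itself.\<close>
      define m2 where "m2 = (\<lambda>j. if j \<le> K then m j else m' j)"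
      define T2 where "T2 = (\<lambda>j. if j \<le> K then T j else T' j)"
      have "tabulates m2 T2 j (1 / 2 ^ j) g" for j
        unfolding tabulates_def
      proof (intro allI ballI impI)
        fix a x assume x: "x \<in> {0..1}" "\<bar>x - rat_num a\<bar> \<le> 1 / 2 ^ m2 j"
        show "\<bar>g x - rat_num (T2 j a)\<bar> \<le> 1 / 2 ^ j"
        proof (cases "j \<le> K")
          case True
          then have "\<bar>f x - rat_num (T j a)\<bar> \<le> 1 / 2 ^ j / 2"
            using mT[of j] x unfolding tabulates_def m2_def by auto
          moreover have "(1::real) / 2 ^ K / 2 \<le> 1 / 2 ^ j / 2"
            using True by (simp add: frac_le)
          moreover have "\<bar>f x - g x\<bar> \<le> mdist C01 f g"
            by (rule C01_dist_pointwise) (use assms g x in auto)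
          ultimately show ?thesis
            using g(2) True unfolding T2_def by (simp add: abs_le_iff)
        next
          case False
          then have "\<bar>g x - rat_num (T' j a)\<bar> \<le> 1 / 2 ^ j / 2"
            using m'T'[of j] x unfolding tabulates_def m2_def by auto
          moreover have "(1::real) / 2 ^ j / 2 \<le> 1 / 2 ^ j"
            by (simp add: field_simps)
          ultimately show ?thesis
            using False unfolding T2_def by simp
        qed
      qed
      then have "rho_to_rho (unary (table m2 T2)) g"
        by (rule rho_to_rho_table[OF g(1)])
      moreover have "table m2 T2 i = table m T i" if "i < n" for i
      proof -
        obtain k as where kas: "(from_nat i :: nat \<times> nat list) = (k, as)"
          by (rule prod.exhaust)
        have "k \<le> K"
          using member_le_sum[of i "{..<n}" "\<lambda>i. fst (from_nat i :: nat \<times> nat list)"] that kas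
          unfolding K_def by simp
        then show ?thesis
          by (auto simp: table_def kas m2_def T2_def simp del: upt_Suc
              intro!: arg_cong[where f = prod_encode] arg_cong[where f = enc])
      qed
      ultimately show ?thesis
        by (metis unary_eq_upto)
    qed
    then show ?thesis
      by (intro exI[of _ "1 / 2 ^ K / 2"]) auto
  qed
  moreover have "tabulates m T j (1 / 2 ^ j) f" for j
    using mT[of j] by (force simp: tabulates_def intro: order_trans)
  ultimately show ?thesis
    using rho_to_rho_table[OF assms] by blast
qed

section \<open>From machines to continuity of the restriction\<close>

lemma mdom_mrestrict: "mdom (mrestrict f D) = mdom f \<inter> D"
  by (auto simp: mdom_def mrestrict_def)

lemma Intermed_C01: "f \<in> mdom Intermed \<Longrightarrow> f \<in> mspace C01"
  by (auto simp: mdom_def Intermed_def split: if_splits)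

lemma in_pos_run: "in_pos (run M I t) i \<le> t"
proof (induction t)
  case 0
  then show ?case by (simp add: run_def init_config_def)
next
  case (Suc t)
  have "in_pos (step M I c) i \<le> Suc (in_pos c i)" for c
    unfolding step_def by (cases "M ! pc c") auto
  then show ?case
    using Suc by (simp add: run_def) (meson Suc_le_mono le_trans)
qed

text \<open>Heads advance by at most one cell per step, so only cells below \<open>t\<close> are
  inspected within \<open>t\<close> steps.\<close>

lemma run_cong:
  assumes "\<And>i n. n < t \<Longrightarrow> I i n = J i n" "t' \<le> t"
  shows "run M I t' = run M J t'"
  using assms(2)
proof (induction t')
  case (Suc t')
  have "I i (in_pos (run M I t') i) = J i (in_pos (run M I t') i)" for i
    using in_pos_run[of M I t' i] Suc.prems by (intro assms(1)) simp
  then have "step M I (run M I t') = step M J (run M I t')"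
    unfolding step_def by (cases "M ! pc (run M I t')") auto
  then show ?case
    using Suc by (simp add: run_def)
qed (simp add: run_def)

text \<open>The running time until \<open>n\<close> symbols are written bounds the part of the name
  that they depend on.\<close>

lemma writes_continuous:
  assumes "writes M (inputs p w) q"
  shows "\<exists>N. \<forall>p' q'. (\<forall>i<N. p i = p' i) \<and> writes M (inputs p' w) q' \<longrightarrow> (\<forall>i<n. q i = q' i)"
proof -
  obtain t where t: "n \<le> length (written (run M (inputs p w) t))"
    using assms by (auto simp: writes_def)
  have "q i = q' i"
    if p': "\<forall>i<t. p i = p' i" and q': "writes M (inputs p' w) q'" and "i < n" for p' q' i
  proof -
    have "run M (inputs p w) t = run M (inputs p' w) t"
      by (rule run_cong[of t]) (use p' in \<open>auto simp: inputs_def\<close>)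
    then have "map q [0..<length (written (run M (inputs p w) t))] =
        map q' [0..<length (written (run M (inputs p w) t))]"
      using assms q' by (metis writes_def)
    then show ?thesis
      using t \<open>i < n\<close> by auto
  qed
  then show ?thesis
    by blast
qed

text \<open>The witness of continuity at \<open>f\<close> is the point that the machine outputs on
  the special name from \<open>rho_to_rho_name_open\<close>. An arbitrary name would not do: its
  prefixes may commit to approximations that are wrong for functions near \<open>f\<close>.\<close>

lemma mcontinuous_if_machine:
  assumes M: "\<And>f p. f \<in> mdom Intermed \<Longrightarrow> f \<in> D \<Longrightarrow> rho_to_rho p f \<Longrightarrow>
      \<exists>q. writes M (inputs p w) q \<and> (\<exists>b\<in>Intermed f. rho q b)"
  shows "mcontinuous (mtopology_of C01) euclidean (mrestrict Intermed D)"
  unfolding mcontinuous_def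
proof
  fix f assume "f \<in> mdom (mrestrict Intermed D)"
  then have f: "f \<in> mdom Intermed" "f \<in> D"
    by (auto simp: mdom_mrestrict)
  then have fC: "f \<in> mspace C01"
    using Intermed_C01 by blast
  obtain p where p: "rho_to_rho p f"
    and near: "\<And>n. \<exists>e>0. \<forall>g\<in>mspace C01. mdist C01 f g < e \<longrightarrow>
           (\<exists>p'. rho_to_rho p' g \<and> (\<forall>i<n. p i = p' i))"
    using rho_to_rho_name_open[OF fC] by blast
  obtain q y where q: "writes M (inputs p w) q" and y: "y \<in> Intermed f" "rho q y"
    using M[OF f p] by blast
  show "mcontinuous_at (mtopology_of C01) euclidean (mrestrict Intermed D) f"
    unfolding mcontinuous_at_def
  proof (intro bexI allI impI)
    show "y \<in> mrestrict Intermed D f"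
      using y(1) f by (simp add: mrestrict_def)
    fix V :: "real set" assume V: "openin euclidean V \<and> y \<in> V"
    then obtain e where e: "0 < e" "\<And>z. \<bar>z - y\<bar> < e \<Longrightarrow> z \<in> V"
      by (metis dist_real_def open_dist open_openin)
    obtain n where n: "\<And>q' y'. rho q' y' \<Longrightarrow> \<forall>i<n. q i = q' i \<Longrightarrow> \<bar>y' - y\<bar> < e"
      using rho_modulus[OF y(2) e(1)] by blast
    obtain N where N: "\<forall>p' q'. (\<forall>i<N. p i = p' i) \<and> writes M (inputs p' w) q' \<longrightarrow>
        (\<forall>i<n. q i = q' i)"
      using writes_continuous[OF q, of n] ..
    obtain r where r: "0 < r" "\<And>g. g \<in> mspace C01 \<Longrightarrow> mdist C01 f g < r \<Longrightarrow>
           \<exists>p'. rho_to_rho p' g \<and> (\<forall>i<N. p i = p' i)"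
      using near[of N] by blast
    let ?U = "{g \<in> mspace C01. mdist C01 f g < r}"
    have "mrestrict Intermed D g \<inter> V \<noteq> {}" if gU: "g \<in> ?U \<inter> mdom (mrestrict Intermed D)" for g
    proof -
      have g: "g \<in> mdom Intermed" "g \<in> D"
        using gU by (auto simp: mdom_mrestrict)
      obtain p' where p': "rho_to_rho p' g" "\<forall>i<N. p i = p' i"
        using r(2)[of g] gU by auto
      obtain q' y' where q': "writes M (inputs p' w) q'" "y' \<in> Intermed g" "rho q' y'"
        using M[OF g p'(1)] by blast
      have "y' \<in> V"
        using e(2) n[OF q'(3)] N p'(2) q'(1) by blast
      then show ?thesis
        using q'(2) g by (auto simp: mrestrict_def)
    qed
    moreover have "f \<in> ?U"
      using C01_dist_self[OF fC] fC r(1) by (metis (mono_tags) mem_Collect_eq)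
    ultimately show "\<exists>U. openin (mtopology_of C01) U \<and> f \<in> U \<and>
        (\<forall>z\<in>U \<inter> mdom (mrestrict Intermed D). mrestrict Intermed D z \<inter> V \<noteq> {})"
      using openin_C01_ball[OF fC, of r] by blast
  qed
qed

section \<open>Zeros on a plateau\<close>

lemma restrict_in_C01: "continuous_on {0..1} h \<Longrightarrow> (\<lambda>x\<in>{0..1}. h x) \<in> mspace C01"
  unfolding mspace_C01 by (auto intro: continuous_on_eq)

text \<open>The signs are prescribed along with the zero set, so that mixing two such functions with
  nested plateaus causes no cancellation.\<close>

definition plateau :: "real \<Rightarrow> real \<Rightarrow> (real \<Rightarrow> real) \<Rightarrow> bool" where
  "plateau a b f \<longleftrightarrow> f \<in> mspace C01 \<and> f ` {0..1} \<subseteq> {-1..1} \<and> f 0 = -1 \<and> f 1 = 1 \<and>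
     (\<forall>x\<in>{0..1}. (x < a \<longrightarrow> f x < 0) \<and> (a \<le> x \<and> x \<le> b \<longrightarrow> f x = 0) \<and> (b < x \<longrightarrow> 0 < f x))"

text \<open>The piecewise linear function through \<open>(0, -1)\<close>, \<open>(a, 0)\<close>,
  \<open>(b, 0)\<close> and \<open>(1, 1)\<close>.\<close>

definition wedge :: "real \<Rightarrow> real \<Rightarrow> real \<Rightarrow> real" where
  "wedge a b = (\<lambda>x\<in>{0..1}. min 0 ((x - a) / a) + max 0 ((x - b) / (1 - b)))"

context
  fixes a b x :: real
  assumes ab: "0 < a" "a < b" "b < 1" and x: "x \<in> {0..1}"
begin

lemma wedge_left: "x \<le> a \<Longrightarrow> wedge a b x = (x - a) / a"
  using ab x by (simp add: wedge_def divide_le_0_iff)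

lemma wedge_mid: "a \<le> x \<Longrightarrow> x \<le> b \<Longrightarrow> wedge a b x = 0"
  using ab x by (simp add: wedge_def divide_le_0_iff)

lemma wedge_right: "b \<le> x \<Longrightarrow> wedge a b x = (x - b) / (1 - b)"
  using ab x by (simp add: wedge_def)

lemma wedge_bounds: "-1 \<le> wedge a b x" "wedge a b x \<le> 1"
proof -
  consider "x \<le> a" | "a \<le> x" "x \<le> b" | "b \<le> x"
    by linarith
  then have "-1 \<le> wedge a b x \<and> wedge a b x \<le> 1"
    by cases (use ab x in \<open>simp_all add: wedge_left wedge_mid wedge_right field_simps\<close>)
  then show "-1 \<le> wedge a b x" "wedge a b x \<le> 1"
    by auto
qed

end

lemma wedge_in_C01: "0 < a \<Longrightarrow> b < 1 \<Longrightarrow> wedge a b \<in> mspace C01"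
  unfolding wedge_def by (intro restrict_in_C01 continuous_intros) auto

lemma plateau_wedge: "0 < a \<Longrightarrow> a < b \<Longrightarrow> b < 1 \<Longrightarrow> plateau a b (wedge a b)"
  unfolding plateau_def
  by (auto simp: wedge_in_C01 wedge_left wedge_right wedge_mid wedge_bounds divide_neg_pos)

text \<open>The function is the convex combination \<open>(1 - e) * f + e * wedge a' b'\<close>.
  Left of \<open>a'\<close> and right of \<open>b'\<close> the summand from \<open>f\<close> has the
  helpful sign, so the linear bounds of the wedge survive; the distance is at most
  \<open>2 * e\<close> because both functions have values in \<open>[-1, 1]\<close>.\<close>

lemma plateau_shrink:
  assumes f: "plateau a b f" and ab: "0 < a" "a \<le> a'" "a' < b'" "b' \<le> b" "b < 1" and e: "0 < e" "e \<le> 1"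
  shows "\<exists>g. plateau a' b' g \<and> mdist C01 f g \<le> 2 * e \<and>
    (\<forall>x\<in>{0..1}. (x \<le> a' \<longrightarrow> g x \<le> e * ((x - a') / a')) \<and>
               (b' \<le> x \<longrightarrow> e * ((x - b') / (1 - b')) \<le> g x))"
proof -
  define L where "L = wedge a' b'"
  define g where "g = (\<lambda>x\<in>{0..1}. (1 - e) * f x + e * L x)"
  have L: "plateau a' b' L"
    unfolding L_def using ab by (intro plateau_wedge) auto
  have gx: "g x = (1 - e) * f x + e * L x" if "x \<in> {0..1}" for x
    using that by (simp add: g_def)
  have f_bd: "-1 \<le> f x" "f x \<le> 1" and L_bd: "-1 \<le> L x" "L x \<le> 1" if "x \<in> {0..1}" for x
    using f L that unfolding plateau_def by (auto simp: image_subset_iff)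
  have f_sgn: "x \<le> b \<Longrightarrow> f x \<le> 0" "a \<le> x \<Longrightarrow> 0 \<le> f x" if "x \<in> {0..1}" for x
    using f that unfolding plateau_def by (metis less_eq_real_def not_le)+
  have g_bd: "-1 \<le> g x" "g x \<le> 1" if x: "x \<in> {0..1}" for x
  proof -
    have "(1 - e) * (-1) + e * (-1) \<le> g x" "g x \<le> (1 - e) * 1 + e * 1"
      unfolding gx[OF x] using e f_bd[OF x] L_bd[OF x] by (intro add_mono mult_left_mono; simp)+
    then show "-1 \<le> g x" "g x \<le> 1"
      by simp_all
  qed
  have g_left: "g x \<le> e * L x" if "x \<in> {0..1}" "x \<le> b" for x
    using f_sgn(1)[of x] that e by (simp add: gx mult_nonneg_nonpos)
  have g_right: "e * L x \<le> g x" if "x \<in> {0..1}" "a \<le> x" for x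
    using f_sgn(2)[of x] that e by (simp add: gx)
  have gC: "g \<in> mspace C01"
    using f L unfolding g_def plateau_def mspace_C01
    by (intro restrict_in_C01[unfolded mspace_C01] continuous_intros) auto
  have "plateau a' b' g"
    unfolding plateau_def
  proof (intro conjI ballI impI)
    show "g \<in> mspace C01" by (rule gC)
    show "g ` {0..1} \<subseteq> {-1..1}"
      using g_bd by auto
    show "g 0 = -1" "g 1 = 1"
      using f L by (simp_all add: gx plateau_def)
    fix x :: real assume x: "x \<in> {0..1}"
    show "g x < 0" if "x < a'"
    proof -
      have "e * L x < 0"
        using L x that e by (simp add: plateau_def mult_pos_neg)
      then show ?thesis
        using g_left[OF x] that ab by linarith
    qed
    show "0 < g x" if "b' < x"
    proof -
      have "0 < e * L x"
        using L x that e by (simp add: plateau_def)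
      then show ?thesis
        using g_right[OF x] that ab by linarith
    qed
    show "g x = 0" if "a' \<le> x \<and> x \<le> b'"
      using L f x that ab by (simp add: gx[OF x] plateau_def)
  qed
  moreover have "mdist C01 f g \<le> 2 * e"
  proof -
    have "\<bar>f x - g x\<bar> \<le> 2 * e" if x: "x \<in> {0..1}" for x
    proof -
      have "f x - g x = e * (f x - L x)"
        by (simp add: gx[OF x] algebra_simps)
      moreover have "\<bar>f x - L x\<bar> \<le> 2"
        using f_bd[OF x] L_bd[OF x] by linarith
      ultimately show ?thesis
        using e by (simp add: abs_mult)
    qed
    then show ?thesis
      using C01_dist_le[OF _ gC] f unfolding plateau_def by blast
  qed
  moreover have "g x \<le> e * ((x - a') / a')" if "x \<in> {0..1}" "x \<le> a'" for x
    using g_left[of x] that ab wedge_left[of a' b' x] unfolding L_def by simp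
  moreover have "e * ((x - b') / (1 - b')) \<le> g x" if "x \<in> {0..1}" "b' \<le> x" for x
    using g_right[of x] that ab wedge_right[of a' b' x] unfolding L_def by simp
  ultimately show ?thesis
    by blast
qed

lemma plateau_mdom:
  assumes "plateau a b f" "0 < a" "a < b" "b < 1"
  shows "f \<in> mdom Intermed"
proof -
  have "a \<in> Intermed f"
    using assms by (auto simp: plateau_def Intermed_def)
  then show ?thesis
    by (auto simp: mdom_def)
qed

text \<open>A value of \<open>f\<close> that is continuously approximated on \<open>D\<close> lies in one half of the plateau;
  moving the plateau into the other half leads to an open set that misses \<open>D\<close>.\<close>

lemma plateau_leave:
  assumes cont: "mcontinuous (mtopology_of C01) euclidean (mrestrict Intermed D)"
    and f: "plateau a b f" and ab: "0 < a" "a < b" "b < 1" and fD: "f \<in> D"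
    and U: "openin (mtopology_of C01) U" "f \<in> U"
  shows "\<exists>a' b' g U'. plateau a' b' g \<and> 0 < a' \<and> a' < b' \<and> b' < 1 \<and> openin (mtopology_of C01) U' \<and>
    g \<in> U' \<and> U' \<subseteq> U \<and> U' \<inter> mdom Intermed \<inter> D = {}"
proof -
  have fC: "f \<in> mspace C01"
    using f by (simp add: plateau_def)
  have "mcontinuous_at (mtopology_of C01) euclidean (mrestrict Intermed D) f"
    using cont plateau_mdom[OF f ab] fD unfolding mcontinuous_def by (simp add: mdom_mrestrict)
  then obtain y where y: "\<forall>V. openin euclidean V \<and> y \<in> V \<longrightarrow>
      (\<exists>U. openin (mtopology_of C01) U \<and> f \<in> U \<and>
        (\<forall>z\<in>U \<inter> mdom (mrestrict Intermed D). mrestrict Intermed D z \<inter> V \<noteq> {}))"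
    unfolding mcontinuous_at_def by (elim bexE)
  \<comment> \<open>For \<open>y\<close> left of the midpoint, \<open>V\<close> is everything left
    of it and the new plateau is the last quarter. Otherwise \<open>y\<close> may be the midpoint
    itself, so the border of the open set \<open>V\<close> is moved to the first quarter point and
    the new plateau is the first eighth. In both cases \<open>d\<close> is the gap between
    \<open>V\<close> and the new plateau.\<close>
  obtain V a' b' d where V: "open V" "y \<in> V" and d: "0 < d"
    and a'b': "a \<le> a'" "a' < b'" "b' \<le> b"
    and far: "\<And>x. x \<in> V \<Longrightarrow> x \<le> a' - d \<or> b' + d \<le> x"
  proof (cases "y < (a + b) / 2")
    case True
    show thesis
      by (rule that[of "{..<(a + b) / 2}" "(b - a) / 4" "(a + 3 * b) / 4" b])
         (use True ab in \<open>auto simp: field_simps\<close>)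
  next
    case False
    show thesis
      by (rule that[of "{(3 * a + b) / 4<..}" "(b - a) / 8" a "(7 * a + b) / 8"])
         (use False ab in \<open>auto simp: field_simps\<close>)
  qed
  have "openin euclidean V \<and> y \<in> V"
    using V by (simp only: open_openin simp_thms)
  from y[THEN spec, THEN mp, OF this]
  obtain U0 where U0: "openin (mtopology_of C01) U0" "f \<in> U0"
    "\<And>z. z \<in> U0 \<Longrightarrow> z \<in> mdom (mrestrict Intermed D) \<Longrightarrow> mrestrict Intermed D z \<inter> V \<noteq> {}"
    by blast
  have UU0: "openin (mtopology_of C01) (U \<inter> U0)"
    using U(1) U0(1) by blast
  then obtain r where r: "0 < r" "\<And>g. g \<in> mspace C01 \<Longrightarrow> mdist C01 f g < r \<Longrightarrow> g \<in> U \<inter> U0"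
    using openin_C01D[of "U \<inter> U0" f] U(2) U0(2) by blast
  \<comment> \<open>At most 1 for the convex combination, and small enough that \<open>2 * e\<close>
    is below the radius \<open>r\<close>.\<close>
  define e where "e = min 1 (r / 3)"
  have e: "0 < e" "e \<le> 1" "2 * e < r"
    using r(1) by (auto simp: e_def min_def)
  obtain g where g: "plateau a' b' g" "mdist C01 f g \<le> 2 * e"
    and g_left: "\<And>x. x \<in> {0..1} \<Longrightarrow> x \<le> a' \<Longrightarrow> g x \<le> e * ((x - a') / a')"
    and g_right: "\<And>x. x \<in> {0..1} \<Longrightarrow> b' \<le> x \<Longrightarrow> e * ((x - b') / (1 - b')) \<le> g x"
    using plateau_shrink[OF f ab(1) a'b' ab(3) e(1,2)] by blast
  have gC: "g \<in> mspace C01"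
    using g(1) by (simp add: plateau_def)
  \<comment> \<open>The slopes \<open>1 / a'\<close> and \<open>1 / (1 - b')\<close> of the wedge
    are at least 1, so a distance \<open>d\<close> from the plateau yields a value of at least
    \<open>e * d\<close>.\<close>
  have far_val: "e * d \<le> \<bar>g x\<bar>" if x: "x \<in> {0..1}" "x \<in> V" for x
  proof -
    consider "x \<le> a' - d" | "b' + d \<le> x"
      using far[OF x(2)] by blast
    then show ?thesis
    proof cases
      case 1
      have "(x - a') / a' \<le> - d / a'"
        using 1 ab a'b' by (intro divide_right_mono) auto
      also have "\<dots> \<le> - d"
        using d ab a'b' by (simp add: field_simps)
      finally have "e * ((x - a') / a') \<le> e * (- d)"
        using e(1) by (intro mult_left_mono) auto
      then show ?thesis
        using g_left[OF x(1)] 1 d by simp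
    next
      case 2
      have "d \<le> d / (1 - b')"
        using d ab a'b' by (simp add: field_simps)
      also have "\<dots> \<le> (x - b') / (1 - b')"
        using 2 ab a'b' by (intro divide_right_mono) auto
      finally have "e * d \<le> e * ((x - b') / (1 - b'))"
        using e(1) by (intro mult_left_mono) auto
      then show ?thesis
        using g_right[OF x(1)] 2 d by simp
    qed
  qed
  \<comment> \<open>Members of \<open>D\<close> in \<open>U0\<close> have a zero in
    \<open>V\<close>, whereas functions within \<open>e * d\<close> of \<open>g\<close> have none
    there.\<close>
  define U' where "U' = (U \<inter> U0) \<inter> {h \<in> mspace C01. mdist C01 g h < e * d}"
  have U': "openin (mtopology_of C01) U'"
    unfolding U'_def using UU0 openin_C01_ball[OF gC] by (rule openin_Int)
  have "g \<in> U \<inter> U0"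
    using r(2)[OF gC] g(2) e(3) by (meson le_less_trans)
  moreover have "mdist C01 g g < e * d"
    by (metis C01_dist_self[OF gC] mult_pos_pos e(1) d)
  ultimately have "g \<in> U'"
    unfolding U'_def using gC by blast
  moreover have False if h: "h \<in> U'" "h \<in> mdom Intermed" "h \<in> D" for h
  proof -
    have "mrestrict Intermed D h \<inter> V \<noteq> {}"
      using U0(3) h unfolding U'_def mdom_mrestrict by blast
    then obtain x where x: "x \<in> V" "x \<in> {0..1}" "h x = 0"
      by (auto simp: mrestrict_def Intermed_def split: if_splits)
    have "\<bar>g x - h x\<bar> \<le> mdist C01 g h"
      using C01_dist_pointwise[OF gC Intermed_C01[OF h(2)] x(2)] .
    then show False
      using far_val[OF x(2,1)] x(3) h(1) unfolding U'_def by auto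
  qed
  moreover have "U' \<subseteq> U"
    unfolding U'_def by blast
  ultimately show ?thesis
    using U' g(1) a'b' ab by (intro exI[of _ a'] exI[of _ b'] exI[of _ g] exI[of _ U']) auto
qed

text \<open>Each step discards the part that contains the current function and shrinks
  \<open>U\<close> to an open set free of that part. Set induction lets the order of the parts
  depend on the functions met on the way.\<close>

lemma finite_family_misses_neighbour:
  assumes "finite \<Delta>" "\<forall>D\<in>\<Delta>. mcontinuous (mtopology_of C01) euclidean (mrestrict Intermed D)"
    "plateau a b f" "0 < a" "a < b" "b < 1" "openin (mtopology_of C01) U" "f \<in> U"
  shows "\<exists>g\<in>U \<inter> mdom Intermed. g \<notin> \<Union>\<Delta>"
  using assms
proof (induction \<Delta> arbitrary: a b f U rule: finite_psubset_induct)
  case (psubset \<Delta>)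
  show ?case
  proof (cases "f \<in> \<Union>\<Delta>")
    case True
    then obtain D where D: "D \<in> \<Delta>" "f \<in> D"
      by blast
    obtain a' b' g U' where g: "plateau a' b' g" "0 < a'" "a' < b'" "b' < 1"
      "openin (mtopology_of C01) U'" "g \<in> U'" "U' \<subseteq> U" "U' \<inter> mdom Intermed \<inter> D = {}"
      using plateau_leave[of D a b f U] psubset.prems D by metis
    have "\<exists>h\<in>U' \<inter> mdom Intermed. h \<notin> \<Union>(\<Delta> - {D})"
      using psubset.IH[of "\<Delta> - {D}"] psubset.prems(1) D(1) g(1-6) by blast
    then show ?thesis
      using g(7,8) by blast
  next
    case False
    then show ?thesis
      using plateau_mdom psubset.prems by blast
  qed
qed

lemma Intermed_no_finite_partition:
  assumes "partition_on (mdom Intermed) \<Delta>"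
    "\<forall>D\<in>\<Delta>. mcontinuous (mtopology_of C01) euclidean (mrestrict Intermed D)"
  shows "infinite \<Delta>"
proof
  assume "finite \<Delta>"
  moreover have "plateau (1 / 3) (2 / 3) (wedge (1 / 3) (2 / 3))"
    by (rule plateau_wedge) auto
  moreover have "openin (mtopology_of C01) (mspace C01)"
    by (metis openin_topspace topspace_mtopology_of)
  moreover have "wedge (1 / 3) (2 / 3) \<in> mspace C01"
    by (rule wedge_in_C01) auto
  ultimately obtain g where "g \<in> mdom Intermed" "g \<notin> \<Union>\<Delta>"
    using finite_family_misses_neighbour[of \<Delta> "1 / 3" "2 / 3" "wedge (1 / 3) (2 / 3)" "mspace C01"]
      assms(2) by auto
  then show False
    using assms(1) by (auto simp: partition_on_def)
qed

section \<open>Selecting from an interval\<close>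

text \<open>Negative information excludes points but never confirms any, so a finite list of
  intervals that avoid \<open>B\<close> can be continued by all rational intervals that avoid
  \<open>B\<close>.\<close>

lemma psi_gt_extends_prefix:
  assumes "closed B" "B \<noteq> {}"
    and s0: "\<And>k. k < n \<Longrightarrow> (case prod_decode (s0 k) of (i, j) \<Rightarrow> {rat_num i<..<rat_num j}) \<subseteq> - B"
  shows "\<exists>s. (\<forall>k<n. s k = s0 k) \<and> psi_gt (unary s) B"
proof -
  define I where "I c = (case prod_decode c of (i, j) \<Rightarrow> {rat_num i<..<rat_num j})" for c
  define N where "N = {c. I c \<subseteq> - B}"
  \<comment> \<open>The code of an empty interval; enumerating \<open>N\<close> with
    \<open>from_nat_into\<close> requires \<open>N\<close> to be nonempty.\<close>
  have "prod_encode (0, 0) \<in> N"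
    by (simp add: N_def I_def)
  then have range_N: "range (from_nat_into N) = N"
    by (intro range_from_nat_into) auto
  define s where "s k = (if k < n then s0 k else from_nat_into N (k - n))" for k
  have "from_nat_into N l \<in> N" for l
    using range_N by blast
  then have "s k \<in> N" for k
    using s0 by (simp add: s_def) (simp add: N_def I_def)
  then have "(\<Union>k. I (s k)) \<subseteq> - B"
    by (auto simp: N_def)
  moreover have "x \<in> (\<Union>k. I (s k))" if x: "x \<in> - B" for x
  proof -
    obtain e where e: "0 < e" "\<And>z. \<bar>z - x\<bar> < e \<Longrightarrow> z \<in> - B"
      using assms(1) x by (metis dist_real_def open_dist open_Compl)
    obtain i where i: "x - e < rat_num i" "rat_num i < x"
      using rat_num_between[of "x - e" x] e(1) by auto
    obtain j where j: "x < rat_num j" "rat_num j < x + e"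
      using rat_num_between[of x "x + e"] e(1) by auto
    have "prod_encode (i, j) \<in> N"
      using i j e(2) by (auto simp: N_def I_def)
    then obtain l where "prod_encode (i, j) = from_nat_into N l"
      using range_N by (metis imageE)
    then have "s (n + l) = prod_encode (i, j)"
      by (simp add: s_def)
    then show ?thesis
      using i j by (intro UN_I[of "n + l"]) (auto simp: I_def)
  qed
  ultimately have "(\<Union>k. I (s k)) = - B"
    by blast
  then have "psi_gt (unary s) B"
    using assms(2) by (auto simp: psi_gt_def I_def)
  then show ?thesis
    by (intro exI[of _ s]) (simp add: s_def)
qed

text \<open>A basic open set of the product topology restricts finitely many coordinates, so
  continuity says that \<open>n\<close> output bits depend on a finite prefix of the input.\<close>

lemma continuous_on_bool_sequences:
  fixes F :: "(nat \<Rightarrow> bool) \<Rightarrow> nat \<Rightarrow> bool"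
  assumes "continuous_on S F" "p \<in> S"
  shows "\<exists>N. \<forall>p'\<in>S. (\<forall>i<N. p i = p' i) \<longrightarrow> (\<forall>i<n. F p i = F p' i)"
proof -
  define B where "B = Pi\<^sub>E UNIV (\<lambda>i. if i < n then {F p i} else UNIV)"
  have "open B"
    unfolding B_def by (intro open_PiE) (auto intro: open_discrete finite_subset[of _ "{..<n}"])
  moreover have "F p \<in> B"
    by (auto simp: B_def)
  ultimately obtain A where A: "open A" "p \<in> A" "\<And>y. y \<in> S \<Longrightarrow> y \<in> A \<Longrightarrow> F y \<in> B"
    using assms unfolding continuous_on_topological by metis
  obtain X where X: "p \<in> Pi\<^sub>E UNIV X" "finite {i. X i \<noteq> UNIV}" "Pi\<^sub>E UNIV X \<subseteq> A"
    using product_topology_open_contains_basis[of "\<lambda>_. euclidean" UNIV A p] A(1,2)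
    by (auto simp: open_fun_def)
  define N where "N = Suc (Max (insert 0 {i. X i \<noteq> UNIV}))"
  have "\<forall>i<n. F p i = F p' i" if "p' \<in> S" "\<forall>i<N. p i = p' i" for p'
  proof -
    have "p' i \<in> X i" for i
    proof (cases "X i = UNIV")
      case False
      then have "i < N"
        using X(2) by (simp add: N_def less_Suc_eq_le)
      then have "p' i = p i"
        using that(2) by simp
      then show ?thesis
        using X(1) by auto
    qed simp
    then have "F p' \<in> B"
      using A(3) that(1) X(3) by blast
    show ?thesis
    proof (intro allI impI)
      fix i assume "i < n"
      moreover have "F p' i \<in> (if i < n then {F p i} else UNIV)"
        using \<open>F p' \<in> B\<close> unfolding B_def by (rule PiE_mem) simp
      ultimately show "F p i = F p' i"
        by simp
    qed
  qed
  then show ?thesis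
    by blast
qed

lemma Select_interval: "0 \<le> a \<Longrightarrow> a < b \<Longrightarrow> b \<le> 1 \<Longrightarrow> Select {a..b} = {a..b}"
  unfolding Select_def by auto

text \<open>A finite prefix of a name of an interval is also a prefix of a name of each
  nondegenerate subinterval, so the realizer for \<open>D\<close> must answer near \<open>y\<close>
  on all of those in \<open>D\<close>. Subintervals far from \<open>y\<close> therefore lie outside
  \<open>D\<close>.\<close>

lemma finite_family_misses_subinterval:
  assumes "finite \<Delta>" "\<forall>D\<in>\<Delta>. rep_continuous psi_gt rho (mrestrict Select D)"
    "0 \<le> a" "a < b" "b \<le> 1"
  shows "\<exists>a' b'. a \<le> a' \<and> a' < b' \<and> b' \<le> b \<and> {a'..b'} \<notin> \<Union>\<Delta>"
  using assms
proof (induction \<Delta> arbitrary: a b rule: finite_psubset_induct)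
  case (psubset \<Delta>)
  show ?case
  proof (cases "{a..b} \<in> \<Union>\<Delta>")
    case True
    then obtain D where D: "D \<in> \<Delta>" "{a..b} \<in> D"
      by blast
    have restr: "mrestrict Select D {a'..b'} = {a'..b'}"
      if "a \<le> a'" "a' < b'" "b' \<le> b" "{a'..b'} \<in> D" for a' b'
      using that psubset.prems Select_interval[of a' b'] by (simp add: mrestrict_def)
    obtain S F where SF: "continuous_on S F" "\<And>B p. B \<in> mdom (mrestrict Select D) \<Longrightarrow> psi_gt p B \<Longrightarrow>
        p \<in> S \<and> (\<exists>y\<in>mrestrict Select D B. rho (F p) y)"
      using psubset.prems(1) D(1) unfolding rep_continuous_def by metis
    have F: "unary s \<in> S \<and> (\<exists>y\<in>{a'..b'}. rho (F (unary s)) y)"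
      if "a \<le> a'" "a' < b'" "b' \<le> b" "{a'..b'} \<in> D" "psi_gt (unary s) {a'..b'}" for a' b' s
      using SF(2)[of "{a'..b'}"] restr[OF that(1-4)] that(2,5) by (auto simp: mdom_def)
    obtain s where s: "psi_gt (unary s) {a..b}"
      using psi_gt_extends_prefix[of "{a..b}" 0] psubset.prems by auto
    obtain y where y: "unary s \<in> S" "y \<in> {a..b}" "rho (F (unary s)) y"
      using F[OF _ _ _ D(2) s] psubset.prems by auto
    \<comment> \<open>The outer quarter on the side opposite to \<open>y\<close> has distance at
      least a quarter of the length from \<open>y\<close>.\<close>
    define e where "e = (b - a) / 4"
    have "0 < e"
      using psubset.prems by (simp add: e_def)
    then obtain n where n: "\<forall>q' y'. rho q' y' \<and> (\<forall>i<n. F (unary s) i = q' i) \<longrightarrow> \<bar>y' - y\<bar> < e"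
      using rho_modulus[OF y(3)] by meson
    obtain N where N: "\<And>p'. p' \<in> S \<Longrightarrow> \<forall>i<N. unary s i = p' i \<Longrightarrow> \<forall>i<n. F (unary s) i = F p' i"
      using continuous_on_bool_sequences[OF SF(1) y(1), of n] by blast
    obtain a' b' where a'b': "a \<le> a'" "a' < b'" "b' \<le> b" and far: "\<And>z. z \<in> {a'..b'} \<Longrightarrow> e \<le> \<bar>z - y\<bar>"
    proof (cases "y < (a + b) / 2")
      case True
      show thesis
        by (rule that[of "(a + 3 * b) / 4" b])
           (use True psubset.prems in \<open>auto simp: e_def field_simps\<close>)
    next
      case False
      show thesis
        by (rule that[of a "(3 * a + b) / 4"])
           (use False psubset.prems in \<open>auto simp: e_def field_simps\<close>)
    qed
    \<comment> \<open>The remaining parts are avoided inside \<open>[a', b']\<close>. Whatever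
      subinterval results still has distance \<open>e\<close> from \<open>y\<close>, so
      \<open>D\<close> is avoided as well.\<close>
    obtain a'' b'' where ab: "a' \<le> a''" "a'' < b''" "b'' \<le> b'" "{a''..b''} \<notin> \<Union>(\<Delta> - {D})"
      using psubset.IH[of "\<Delta> - {D}" a' b'] psubset.prems D(1) a'b' by auto
    have "{a''..b''} \<notin> D"
    proof
      assume D': "{a''..b''} \<in> D"
      have "(case prod_decode (s k) of (i, j) \<Rightarrow> {rat_num i<..<rat_num j}) \<subseteq> - {a''..b''}" for k
      proof -
        have "(case prod_decode (s k) of (i, j) \<Rightarrow> {rat_num i<..<rat_num j}) \<subseteq> - {a..b}"
          using s unfolding psi_gt_def by (metis UN_upper UNIV_I unary_inject)
        then show ?thesis
          using a'b' ab by fastforce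
      qed
      then obtain s' where s': "\<forall>k<N. s' k = s k" "psi_gt (unary s') {a''..b''}"
        using psi_gt_extends_prefix[of "{a''..b''}" N s] ab(2) by auto
      obtain y' where y': "unary s' \<in> S" "y' \<in> {a''..b''}" "rho (F (unary s')) y'"
        using F[OF _ ab(2) _ D' s'(2)] a'b' ab by auto
      have "\<bar>y' - y\<bar> < e"
        using n y'(3) N[OF y'(1)] unary_eq_upto[of N s s'] s'(1) by metis
      then show False
        using far[of y'] y'(2) ab by auto
    qed
    then show ?thesis
      using ab a'b' by (intro exI[of _ a''] exI[of _ b'']) auto
  next
    case False
    then show ?thesis
      using psubset.prems by blast
  qed
qed

lemma Select_not_wise_continuous: "\<not> wise_rep_continuous d psi_gt rho Select"
proof
  assume "wise_rep_continuous d psi_gt rho Select"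
  then obtain \<Delta> where \<Delta>: "partition_on (mdom Select) \<Delta>" "finite \<Delta>"
      "\<forall>D\<in>\<Delta>. rep_continuous psi_gt rho (mrestrict Select D)"
    unfolding wise_rep_continuous_def by blast
  obtain a b :: real where ab: "0 \<le> a" "a < b" "b \<le> 1" "{a..b} \<notin> \<Union>\<Delta>"
    using finite_family_misses_subinterval[OF \<Delta>(2,3), of 0 1] by auto
  then have "{a..b} \<in> mdom Select"
    using Select_interval[of a b] by (auto simp: mdom_def)
  then show False
    using \<Delta>(1) ab(4) by (simp add: partition_on_def)
qed

section \<open>Register programs on Type-2 machines\<close>

text \<open>A small imperative language over natural number registers. Register \<open>r\<close> is held as the head
  position on work tape \<open>r\<close>, whose only non-blank cell is cell 0, so that the test for 0 is the
  inspection of a symbol.\<close>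

datatype cmd =
    Skip
  | Inc nat
  | Dec nat
  | Adv nat
  | Emit bool
  | Seq cmd cmd
  | WhileReg nat cmd
  | WhileIn nat symbol cmd

primrec csize :: "cmd \<Rightarrow> nat" where
  "csize Skip = 0"
| "csize (Inc r) = 1"
| "csize (Dec r) = 1"
| "csize (Adv i) = 1"
| "csize (Emit b) = 1"
| "csize (Seq c d) = csize c + csize d"
| "csize (WhileReg r c) = csize c + 2"
| "csize (WhileIn i a c) = csize c + 2"

text \<open>Jumps are absolute, so \<open>b\<close> is the address at which the code is loaded. A
  loop adds a test and a jump back, hence the exit address \<open>b + csize c + 2\<close>.\<close>

primrec compile :: "cmd \<Rightarrow> nat \<Rightarrow> machine" where
  "compile Skip b = []"
| "compile (Inc r) b = [WorkRight r]"
| "compile (Dec r) b = [WorkLeft r]"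
| "compile (Adv i) b = [InRight i]"
| "compile (Emit x) b = [Out x]"
| "compile (Seq c d) b = compile c b @ compile d (b + csize c)"
| "compile (WhileReg r c) b =
     WorkBranch r (Some True) (b + csize c + 2) # compile c (Suc b) @ [Goto b]"
| "compile (WhileIn i a c) b =
     InBranch i a (b + csize c + 2) # compile c (Suc b) @ [Goto b]"

primrec reg_bound :: "cmd \<Rightarrow> nat" where
  "reg_bound Skip = 0"
| "reg_bound (Inc r) = Suc r"
| "reg_bound (Dec r) = Suc r"
| "reg_bound (Adv i) = 0"
| "reg_bound (Emit x) = 0"
| "reg_bound (Seq c d) = max (reg_bound c) (reg_bound d)"
| "reg_bound (WhileReg r c) = max (Suc r) (reg_bound c)"
| "reg_bound (WhileIn i a c) = reg_bound c"

text \<open>The components of a state are the registers, the input positions and the output so far.\<close>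

type_synonym state = "(nat \<Rightarrow> nat) \<times> (nat \<Rightarrow> nat) \<times> bool list"

text \<open>Only terminating runs are described; the endless main loop is left to
  \<open>loop_machine\<close>. \<open>Dec\<close> has no rule at 0, which keeps heads from passing
  the marked cell to the left.\<close>

inductive big :: "(nat \<Rightarrow> nat \<Rightarrow> symbol) \<Rightarrow> cmd \<Rightarrow> state \<Rightarrow> state \<Rightarrow> bool" for I where
  big_Skip: "big I Skip s s"
| big_Inc: "big I (Inc r) (\<sigma>, p, w) (\<sigma>(r := Suc (\<sigma> r)), p, w)"
| big_Dec: "\<sigma> r = Suc n \<Longrightarrow> big I (Dec r) (\<sigma>, p, w) (\<sigma>(r := n), p, w)"
| big_Adv: "big I (Adv i) (\<sigma>, p, w) (\<sigma>, p(i := Suc (p i)), w)"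
| big_Emit: "big I (Emit x) (\<sigma>, p, w) (\<sigma>, p, w @ [x])"
| big_Seq: "big I c s s' \<Longrightarrow> big I d s' s'' \<Longrightarrow> big I (Seq c d) s s''"
| big_WhileReg_done: "\<sigma> r = 0 \<Longrightarrow> big I (WhileReg r c) (\<sigma>, p, w) (\<sigma>, p, w)"
| big_WhileReg_step: "\<sigma> r \<noteq> 0 \<Longrightarrow> big I c (\<sigma>, p, w) s' \<Longrightarrow> big I (WhileReg r c) s' s'' \<Longrightarrow>
    big I (WhileReg r c) (\<sigma>, p, w) s''"
| big_WhileIn_done: "I i (p i) = a \<Longrightarrow> big I (WhileIn i a c) (\<sigma>, p, w) (\<sigma>, p, w)"
| big_WhileIn_step: "I i (p i) \<noteq> a \<Longrightarrow> big I c (\<sigma>, p, w) s' \<Longrightarrow> big I (WhileIn i a c) s' s'' \<Longrightarrow>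
    big I (WhileIn i a c) (\<sigma>, p, w) s''"

definition marked :: "int \<Rightarrow> symbol" where
  "marked = (\<lambda>x. if x = 0 then Some True else None)"

fun represents :: "nat \<Rightarrow> config \<Rightarrow> state \<Rightarrow> bool" where
  "represents R c (\<sigma>, p, w) \<longleftrightarrow>
     (\<forall>j<R. work c j = marked \<and> work_pos c j = int (\<sigma> j)) \<and> in_pos c = p \<and> written c = w"

definition code_at :: "machine \<Rightarrow> nat \<Rightarrow> machine \<Rightarrow> bool" where
  "code_at M b xs \<longleftrightarrow> (\<forall>i<length xs. b + i < length M \<and> M ! (b + i) = xs ! i)"

lemma code_at_append: "code_at (pre @ xs @ post) (length pre) xs"
  by (auto simp: code_at_def nth_append)

lemma code_at_appendD:
  assumes "code_at M b (xs @ ys)"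
  shows "code_at M b xs" "code_at M (b + length xs) ys"
proof -
  show "code_at M b xs"
    unfolding code_at_def
  proof (intro allI impI)
    fix i assume "i < length xs"
    then show "b + i < length M \<and> M ! (b + i) = xs ! i"
      using assms[unfolded code_at_def, rule_format, of i] by (simp add: nth_append)
  qed
  show "code_at M (b + length xs) ys"
    unfolding code_at_def
  proof (intro allI impI)
    fix i assume "i < length ys"
    then show "b + length xs + i < length M \<and> M ! (b + length xs + i) = ys ! i"
      using assms[unfolded code_at_def, rule_format, of "length xs + i"]
      by (simp add: nth_append add.assoc)
  qed
qed

lemma code_at_ConsD:
  assumes "code_at M b (x # xs)"
  shows "b < length M" "M ! b = x" "code_at M (Suc b) xs"
  using code_at_appendD[of M b "[x]" xs] assms by (auto simp: code_at_def)

lemma step_code: "code_at M b (x # xs) \<Longrightarrow> pc c = b \<Longrightarrow> step M I c = exec I x c"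
  using code_at_ConsD[of M b x xs] by (simp add: step_def)

lemma length_compile [simp]: "length (compile c b) = csize c"
  by (induction c arbitrary: b) auto

definition reaches :: "machine \<Rightarrow> (nat \<Rightarrow> nat \<Rightarrow> symbol) \<Rightarrow> config \<Rightarrow> config \<Rightarrow> bool" where
  "reaches M I c c' \<longleftrightarrow> (\<exists>t. c' = (step M I ^^ t) c)"

lemma reaches_refl: "reaches M I c c"
  unfolding reaches_def by (rule exI[of _ 0]) simp

lemma reaches_step: "reaches M I (step M I c) c' \<Longrightarrow> reaches M I c c'"
  unfolding reaches_def by (metis comp_apply funpow_Suc_right)

lemma reaches_one: "reaches M I c (step M I c)"
  by (rule reaches_step, rule reaches_refl)

lemma reaches_trans: "reaches M I c c' \<Longrightarrow> reaches M I c' c'' \<Longrightarrow> reaches M I c c''"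
  unfolding reaches_def by (metis comp_apply funpow_add)

lemma compile_correct:
  assumes "big I c s s'" "reg_bound c \<le> R" "code_at M b (compile c b)" "pc cf = b"
    "represents R cf s"
  shows "\<exists>cf'. reaches M I cf cf' \<and> pc cf' = b + csize c \<and> represents R cf' s'"
  using assms
proof (induction arbitrary: b cf rule: big.induct)
  case (big_Skip s)
  then show ?case
    using reaches_refl by auto
next
  case (big_Inc r \<sigma> p w)
  then have "step M I cf = exec I (WorkRight r) cf"
    using step_code[of M b] by simp
  then show ?case
    using big_Inc by (intro exI[of _ "step M I cf"] conjI reaches_one) auto
next
  case (big_Dec \<sigma> r n p w)
  then have "step M I cf = exec I (WorkLeft r) cf"
    using step_code[of M b] by simp
  then show ?case
    using big_Dec by (intro exI[of _ "step M I cf"] conjI reaches_one) auto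
next
  case (big_Adv i \<sigma> p w)
  then have "step M I cf = exec I (InRight i) cf"
    using step_code[of M b] by simp
  then show ?case
    using big_Adv by (intro exI[of _ "step M I cf"] conjI reaches_one) auto
next
  case (big_Emit x \<sigma> p w)
  then have "step M I cf = exec I (Out x) cf"
    using step_code[of M b] by simp
  then show ?case
    using big_Emit by (intro exI[of _ "step M I cf"] conjI reaches_one) auto
next
  case (big_Seq c s s' d s'')
  have "code_at M b (compile c b)" "code_at M (b + csize c) (compile d (b + csize c))"
    using code_at_appendD[of M b "compile c b"] big_Seq.prems(2) by auto
  moreover obtain cf' where cf': "reaches M I cf cf'" "pc cf' = b + csize c" "represents R cf' s'"
    using big_Seq.IH(1)[of b cf] big_Seq.prems calculation by auto
  ultimately obtain cf'' where "reaches M I cf' cf''" "pc cf'' = b + csize c + csize d"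
      "represents R cf'' s''"
    using big_Seq.IH(2)[of "b + csize c" cf'] big_Seq.prems by auto
  then show ?case
    using reaches_trans[OF cf'(1)] by (auto simp: add.assoc)
next
  case (big_WhileReg_done \<sigma> r c p w)
  have "step M I cf = cf\<lparr>pc := b + csize c + 2\<rparr>"
    using big_WhileReg_done code_at_ConsD[of M b] by (auto simp: step_def marked_def)
  then show ?case
    using big_WhileReg_done by (intro exI[of _ "step M I cf"] conjI reaches_one) auto
next
  case (big_WhileReg_step \<sigma> r c p w s' s'')
  have code: "b < length M" "M ! b = WorkBranch r (Some True) (b + csize c + 2)"
    "code_at M (Suc b) (compile c (Suc b))" "code_at M (Suc b + csize c) [Goto b]"
    using code_at_ConsD[OF big_WhileReg_step.prems(2)[simplified]]
      code_at_appendD[of M "Suc b" "compile c (Suc b)"] by auto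
  have "step M I cf = cf\<lparr>pc := Suc b\<rparr>"
    using big_WhileReg_step code by (auto simp: step_def marked_def)
  then have 1: "reaches M I cf (cf\<lparr>pc := Suc b\<rparr>)"
    by (metis reaches_one)
  obtain cf' where cf': "reaches M I (cf\<lparr>pc := Suc b\<rparr>) cf'" "pc cf' = Suc b + csize c"
      "represents R cf' s'"
    using big_WhileReg_step.IH(1)[of "Suc b" "cf\<lparr>pc := Suc b\<rparr>"] big_WhileReg_step.prems code by auto
  have "step M I cf' = cf'\<lparr>pc := b\<rparr>"
    using cf'(2) code_at_ConsD[OF code(4)] by (auto simp: step_def)
  then have 2: "reaches M I cf' (cf'\<lparr>pc := b\<rparr>)"
    by (metis reaches_one)
  have "represents R (cf'\<lparr>pc := b\<rparr>) s'"
    using cf'(3) by (cases s') auto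
  then obtain cf'' where "reaches M I (cf'\<lparr>pc := b\<rparr>) cf''" "pc cf'' = b + csize (WhileReg r c)"
      "represents R cf'' s''"
    using big_WhileReg_step.IH(2)[of b "cf'\<lparr>pc := b\<rparr>"] big_WhileReg_step.prems by auto
  then show ?case
    using 1 2 cf'(1) reaches_trans by metis
next
  case (big_WhileIn_done i p a c \<sigma> w)
  have "step M I cf = cf\<lparr>pc := b + csize c + 2\<rparr>"
    using big_WhileIn_done code_at_ConsD[of M b] by (auto simp: step_def)
  then show ?case
    using big_WhileIn_done by (intro exI[of _ "step M I cf"] conjI reaches_one) auto
next
  case (big_WhileIn_step i p a c \<sigma> w s' s'')
  have code: "b < length M" "M ! b = InBranch i a (b + csize c + 2)"
    "code_at M (Suc b) (compile c (Suc b))" "code_at M (Suc b + csize c) [Goto b]"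
    using code_at_ConsD[OF big_WhileIn_step.prems(2)[simplified]]
      code_at_appendD[of M "Suc b" "compile c (Suc b)"] by auto
  have "step M I cf = cf\<lparr>pc := Suc b\<rparr>"
    using big_WhileIn_step code by (auto simp: step_def)
  then have 1: "reaches M I cf (cf\<lparr>pc := Suc b\<rparr>)"
    by (metis reaches_one)
  obtain cf' where cf': "reaches M I (cf\<lparr>pc := Suc b\<rparr>) cf'" "pc cf' = Suc b + csize c"
      "represents R cf' s'"
    using big_WhileIn_step.IH(1)[of "Suc b" "cf\<lparr>pc := Suc b\<rparr>"] big_WhileIn_step.prems code by auto
  have "step M I cf' = cf'\<lparr>pc := b\<rparr>"
    using cf'(2) code_at_ConsD[OF code(4)] by (auto simp: step_def)
  then have 2: "reaches M I cf' (cf'\<lparr>pc := b\<rparr>)"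
    by (metis reaches_one)
  have "represents R (cf'\<lparr>pc := b\<rparr>) s'"
    using cf'(3) by (cases s') auto
  then obtain cf'' where "reaches M I (cf'\<lparr>pc := b\<rparr>) cf''" "pc cf'' = b + csize (WhileIn i a c)"
      "represents R cf'' s''"
    using big_WhileIn_step.IH(2)[of b "cf'\<lparr>pc := b\<rparr>"] big_WhileIn_step.prems by auto
  then show ?case
    using 1 2 cf'(1) reaches_trans by metis
qed

text \<open>Tapes start blank, while \<open>represents\<close> demands a mark in cell 0. The
  induction must also carry that the tapes not yet treated are blank and all heads are at 0.\<close>

lemma mark_tapes:
  assumes "code_at M 0 (map (\<lambda>j. WorkWrite j (Some True)) [0..<R])" "k \<le> R"
  shows "\<exists>cf. reaches M I init_config cf \<and> pc cf = k \<and> represents k cf ((\<lambda>_. 0), (\<lambda>_. 0), []) \<and>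
    (\<forall>j\<ge>k. work cf j = (\<lambda>_. None)) \<and> (\<forall>j. work_pos cf j = 0)"
  using assms(2)
proof (induction k)
  case 0
  then show ?case
    by (intro exI[of _ init_config]) (auto simp: reaches_refl init_config_def)
next
  case (Suc k)
  then obtain cf where cf: "reaches M I init_config cf" "pc cf = k"
    "represents k cf ((\<lambda>_. 0), (\<lambda>_. 0), [])"
    "\<forall>j\<ge>k. work cf j = (\<lambda>_. None)" "\<forall>j. work_pos cf j = 0"
    by auto
  have "step M I cf = cf\<lparr>pc := Suc k, work := (work cf)(k := marked)\<rparr>"
    using assms(1)[unfolded code_at_def, rule_format, of k] Suc.prems cf(2,4,5)
    by (auto simp: step_def marked_def fun_eq_iff)
  moreover have "reaches M I init_config (step M I cf)"
    using cf(1) reaches_one reaches_trans by blast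
  ultimately show ?case
    using cf by (intro exI[of _ "step M I cf"]) (auto simp: less_Suc_eq)
qed

text \<open>The endless loop is a \<open>while\<close> whose exit symbol never occurs on the input tape.\<close>

lemma loop_machine:
  "\<exists>M. \<forall>I S. (\<forall>n. I 0 n \<noteq> None) \<and> big I init ((\<lambda>_. 0), (\<lambda>_. 0), []) (S 0) \<and>
     (\<forall>n. big I body (S n) (S (Suc n))) \<longrightarrow> (\<forall>n. \<exists>t. written (run M I t) = snd (snd (S n)))"
proof -
  define R where "R = max (reg_bound init) (reg_bound body)"
  define marks where "marks = map (\<lambda>j. WorkWrite j (Some True)) [0..<R]"
  define l where "l = R + csize init"
  define M where "M = marks @ compile init R @ compile (WhileIn 0 None body) l"
  have len: "length marks = R"
    by (simp add: marks_def)
  have marks: "code_at M 0 marks"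
    using code_at_append[of "[]" marks "compile init R @ compile (WhileIn 0 None body) l"]
    by (simp add: M_def)
  have init: "code_at M R (compile init R)"
    using code_at_append[of marks "compile init R" "compile (WhileIn 0 None body) l"]
    by (simp add: M_def len)
  have code: "code_at M l (compile (WhileIn 0 None body) l)"
    using code_at_append[of "marks @ compile init R" "compile (WhileIn 0 None body) l" "[]"]
    by (simp add: M_def l_def len)
 have loop: "l < length M" "M ! l = InBranch 0 None (l + csize body + 2)"
    "code_at M (Suc l) (compile body (Suc l))" "code_at M (Suc l + csize body) [Goto l]"
    using code_at_ConsD[OF code[simplified]] code_at_appendD[of M "Suc l" "compile body (Suc l)"]
    by auto
  have "\<exists>t. written (run M I t) = snd (snd (S n))"
    if I: "\<And>n. I 0 n \<noteq> None" and S0: "big I init ((\<lambda>_. 0), (\<lambda>_. 0), []) (S 0)"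
      and S: "\<And>n. big I body (S n) (S (Suc n))" for I S n
  proof -
    have "\<exists>cf. reaches M I init_config cf \<and> pc cf = l \<and> represents R cf (S n)"
    proof (induction n)
      case 0
      obtain cf where cf: "reaches M I init_config cf" "pc cf = R"
          "represents R cf ((\<lambda>_. 0), (\<lambda>_. 0), [])"
        using mark_tapes[of M R R I] marks by (auto simp: marks_def)
      obtain cf' where "reaches M I cf cf'" "pc cf' = l" "represents R cf' (S 0)"
        using compile_correct[OF S0 _ init cf(2,3)] by (auto simp: R_def l_def)
      then show ?case
        using reaches_trans[OF cf(1)] by blast
    next
      case (Suc n)
      then obtain cf where cf: "reaches M I init_config cf" "pc cf = l" "represents R cf (S n)"
        by blast
      have "step M I cf = cf\<lparr>pc := Suc l\<rparr>"
        using cf(2) loop I by (auto simp: step_def)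
      then have 1: "reaches M I cf (cf\<lparr>pc := Suc l\<rparr>)"
        by (metis reaches_one)
      have "represents R (cf\<lparr>pc := Suc l\<rparr>) (S n)"
        using cf(3) by (cases "S n") auto
      moreover have "reg_bound body \<le> R" "pc (cf\<lparr>pc := Suc l\<rparr>) = Suc l"
        by (simp_all add: R_def)
      ultimately obtain cf' where cf': "reaches M I (cf\<lparr>pc := Suc l\<rparr>) cf'"
          "pc cf' = Suc l + csize body" "represents R cf' (S (Suc n))"
        using compile_correct[OF S _ loop(3)] by blast
      have "step M I cf' = cf'\<lparr>pc := l\<rparr>"
        using cf'(2) code_at_ConsD[OF loop(4)] by (auto simp: step_def)
      then have 2: "reaches M I cf' (cf'\<lparr>pc := l\<rparr>)"
        by (metis reaches_one)
      have "represents R (cf'\<lparr>pc := l\<rparr>) (S (Suc n))"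
        using cf'(3) by (cases "S (Suc n)") auto
      then show ?case
        using cf(1) 1 cf'(1) 2 reaches_trans
        by (intro exI[of _ "cf'\<lparr>pc := l\<rparr>"] conjI) (blast, auto)
    qed
    then obtain cf where "reaches M I init_config cf" "represents R cf (S n)"
      by blast
    then show ?thesis
      unfolding reaches_def run_def by (cases "S n") auto
  qed
  then show ?thesis
    by blast
qed

section \<open>Register-computable functions\<close>

definition transforms :: "cmd \<Rightarrow> ((nat \<Rightarrow> nat) \<Rightarrow> nat \<Rightarrow> nat) \<Rightarrow> bool" where
  "transforms C f \<longleftrightarrow> (\<forall>I \<sigma> p w. big I C (\<sigma>, p, w) (f \<sigma>, p, w))"

lemma transforms_Inc: "transforms (Inc r) (\<lambda>\<sigma>. \<sigma>(r := Suc (\<sigma> r)))"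
  by (simp add: transforms_def big_Inc)

lemma transforms_Seq: "transforms C f \<Longrightarrow> transforms D g \<Longrightarrow> transforms (Seq C D) (\<lambda>\<sigma>. g (f \<sigma>))"
  unfolding transforms_def by (blast intro: big_Seq)

text \<open>The conditions on \<open>g\<close> are a recursion on the counter \<open>r\<close>; as
  the body preserves \<open>r\<close>, the decrement makes the loop terminate.\<close>

lemma transforms_loop:
  assumes C: "transforms C f" and keep: "\<And>\<sigma>. f \<sigma> r = \<sigma> r"
    and g0: "\<And>\<sigma>. \<sigma> r = 0 \<Longrightarrow> g \<sigma> = \<sigma>" and gS: "\<And>\<sigma> n. \<sigma> r = Suc n \<Longrightarrow> g \<sigma> = g (f (\<sigma>(r := n)))"
  shows "transforms (WhileReg r (Seq (Dec r) C)) g"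
  unfolding transforms_def
proof (intro allI)
  fix I \<sigma> p w
  show "big I (WhileReg r (Seq (Dec r) C)) (\<sigma>, p, w) (g \<sigma>, p, w)"
  proof (induction "\<sigma> r" arbitrary: \<sigma>)
    case 0
    then show ?case
      using g0[of \<sigma>] by (auto intro: big_WhileReg_done)
  next
    case (Suc n)
    have "big I (Seq (Dec r) C) (\<sigma>, p, w) (f (\<sigma>(r := n)), p, w)"
      using C Suc.hyps(2)[symmetric] unfolding transforms_def by (blast intro: big_Seq big_Dec)
    moreover have "big I (WhileReg r (Seq (Dec r) C)) (f (\<sigma>(r := n)), p, w) (g \<sigma>, p, w)"
      using Suc.hyps(1)[of "f (\<sigma>(r := n))"] Suc.hyps(2) keep[of "\<sigma>(r := n)"] gS[of \<sigma> n] by simp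
    ultimately show ?case
      using Suc.hyps(2) by (metis big_WhileReg_step nat.distinct(1))
  qed
qed

definition clear :: "nat \<Rightarrow> cmd" where
  "clear r = WhileReg r (Seq (Dec r) Skip)"

lemma transforms_clear: "transforms (clear r) (\<lambda>\<sigma>. \<sigma>(r := 0))"
  unfolding clear_def
  by (rule transforms_loop[where f = "\<lambda>\<sigma>. \<sigma>"]) (auto simp: transforms_def big_Skip)

definition move :: "nat \<Rightarrow> nat \<Rightarrow> cmd" where
  "move s d = Seq (clear d) (WhileReg s (Seq (Dec s) (Inc d)))"

lemma transforms_move:
  assumes "s \<noteq> d"
  shows "transforms (move s d) (\<lambda>\<sigma>. \<sigma>(d := \<sigma> s, s := 0))"
proof -
  have "transforms (WhileReg s (Seq (Dec s) (Inc d))) (\<lambda>\<sigma>. \<sigma>(d := \<sigma> d + \<sigma> s, s := 0))"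
    by (rule transforms_loop[OF transforms_Inc]) (use assms in \<open>auto simp: fun_eq_iff\<close>)
  from transforms_Seq[OF transforms_clear this, of d] show ?thesis
    using assms by (simp add: move_def)
qed

text \<open>Reading a register means counting it down, so a second copy is built up in
  \<open>e\<close> and moved back.\<close>

definition copy :: "nat \<Rightarrow> nat \<Rightarrow> nat \<Rightarrow> cmd" where
  "copy s d e = Seq (clear d) (Seq (clear e)
     (Seq (WhileReg s (Seq (Dec s) (Seq (Inc d) (Inc e)))) (move e s)))"

lemma transforms_copy:
  assumes "s \<noteq> d" "s \<noteq> e" "d \<noteq> e"
  shows "transforms (copy s d e) (\<lambda>\<sigma>. \<sigma>(d := \<sigma> s, e := 0))"
proof -
  have "transforms (WhileReg s (Seq (Dec s) (Seq (Inc d) (Inc e))))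
      (\<lambda>\<sigma>. \<sigma>(d := \<sigma> d + \<sigma> s, e := \<sigma> e + \<sigma> s, s := 0))"
    by (rule transforms_loop[OF transforms_Seq[OF transforms_Inc transforms_Inc]])
       (use assms in \<open>auto simp: fun_eq_iff\<close>)
  from transforms_Seq[OF transforms_clear[of d] transforms_Seq[OF transforms_clear[of e]
      transforms_Seq[OF this transforms_move[of e s]]]]
  have "transforms (copy s d e) (\<lambda>\<sigma>. (\<sigma>(d := \<sigma> s, e := 0))(s := \<sigma> s, e := 0))"
    using assms by (simp add: copy_def fun_upd_twist)
  moreover have "(\<sigma>(d := \<sigma> s, e := 0))(s := \<sigma> s, e := 0) = \<sigma>(d := \<sigma> s, e := 0)" for \<sigma> :: "nat \<Rightarrow> nat"
    using assms by (auto simp: fun_eq_iff)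
  ultimately show ?thesis
    by simp
qed

text \<open>\<open>a i\<close> is the address of the register that holds argument number \<open>i\<close>, register \<open>d\<close> receives the
  value, and the registers above \<open>d\<close> are free for intermediate results. Addressing makes variable
  renaming free of charge.\<close>

definition register_computable :: "((nat \<Rightarrow> nat) \<Rightarrow> nat) \<Rightarrow> bool" where
  "register_computable F \<longleftrightarrow> (\<forall>a d. (\<forall>i. a i < d) \<longrightarrow>
     (\<exists>C f. transforms C f \<and> (\<forall>\<sigma>. f \<sigma> d = F (\<sigma> \<circ> a) \<and> (\<forall>x<d. f \<sigma> x = \<sigma> x))))"

lemma register_computableI:
  "(\<And>a d. \<forall>i. a i < d \<Longrightarrow>
     \<exists>C f. transforms C f \<and> (\<forall>\<sigma>. f \<sigma> d = F (\<sigma> \<circ> a) \<and> (\<forall>x<d. f \<sigma> x = \<sigma> x))) \<Longrightarrow>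
   register_computable F"
  by (simp add: register_computable_def)

lemma register_computableE:
  assumes "register_computable F" "\<forall>i. a i < d"
  obtains C f where "transforms C f" "\<And>\<sigma>. f \<sigma> d = F (\<sigma> \<circ> a)" "\<And>\<sigma> x. x < d \<Longrightarrow> f \<sigma> x = \<sigma> x"
proof -
  obtain C f where "transforms C f \<and> (\<forall>\<sigma>. f \<sigma> d = F (\<sigma> \<circ> a) \<and> (\<forall>x<d. f \<sigma> x = \<sigma> x))"
    using assms(1)[unfolded register_computable_def, THEN spec, THEN spec, THEN mp, OF assms(2)]
    by (elim exE)
  then show thesis
    by (intro that[of C f]) auto
qed

named_theorems rc_intros

lemma rc_proj [rc_intros]: "register_computable (\<lambda>v. v k)"
proof (rule register_computableI)
  fix a :: "nat \<Rightarrow> nat" and d assume "\<forall>i. a i < d"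
  then have "a k < d"
    by blast
  then show "\<exists>C f. transforms C f \<and> (\<forall>\<sigma>. f \<sigma> d = (\<sigma> \<circ> a) k \<and> (\<forall>x<d. f \<sigma> x = \<sigma> x))"
    by (intro exI[of _ "copy (a k) d (Suc d)"] exI[of _ "\<lambda>\<sigma>. \<sigma>(d := \<sigma> (a k), Suc d := 0)"])
       (auto intro!: transforms_copy)
qed

lemma rc_zero: "register_computable (\<lambda>_. 0)"
  by (rule register_computableI, intro exI conjI, rule transforms_clear) auto

lemma rc_Suc [rc_intros]:
  assumes "register_computable F"
  shows "register_computable (\<lambda>v. Suc (F v))"
proof (rule register_computableI)
  fix a :: "nat \<Rightarrow> nat" and d assume "\<forall>i. a i < d"
  with assms obtain C f where "transforms C f" "\<And>\<sigma>. f \<sigma> d = F (\<sigma> \<circ> a)"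
      "\<And>\<sigma> x. x < d \<Longrightarrow> f \<sigma> x = \<sigma> x"
    by (rule register_computableE) (rule that)
  then show "\<exists>C f. transforms C f \<and> (\<forall>\<sigma>. f \<sigma> d = Suc (F (\<sigma> \<circ> a)) \<and> (\<forall>x<d. f \<sigma> x = \<sigma> x))"
    using transforms_Seq[OF _ transforms_Inc[of d], of C f]
    by (intro exI[of _ "Seq C (Inc d)"] exI[of _ "\<lambda>\<sigma>. (f \<sigma>)(d := Suc (f \<sigma> d))"]) auto
qed

lemma rc_const [rc_intros]: "register_computable (\<lambda>_. c)"
  by (induction c) (auto intro: rc_zero rc_Suc)

lemma rc_rename:
  assumes "register_computable F"
  shows "register_computable (\<lambda>v. F (\<lambda>i. v (r i)))"
proof (rule register_computableI)
  fix a :: "nat \<Rightarrow> nat" and d assume "\<forall>i. a i < d"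
  then have "\<forall>i. (a \<circ> r) i < d"
    by simp
  with assms obtain C f where "transforms C f" "\<And>\<sigma>. f \<sigma> d = F (\<sigma> \<circ> (a \<circ> r))"
      "\<And>\<sigma> x. x < d \<Longrightarrow> f \<sigma> x = \<sigma> x"
    by (rule register_computableE) (rule that)
  then show "\<exists>C f. transforms C f \<and>
      (\<forall>\<sigma>. f \<sigma> d = F (\<lambda>i. (\<sigma> \<circ> a) (r i)) \<and> (\<forall>x<d. f \<sigma> x = \<sigma> x))"
    by (intro exI[of _ C] exI[of _ f]) (simp add: comp_def)
qed

text \<open>Recursion with falling index: this is what a loop computes whose counter is decremented
  before the body.\<close>

primrec down_rec :: "(nat \<Rightarrow> nat \<Rightarrow> nat) \<Rightarrow> nat \<Rightarrow> nat \<Rightarrow> nat" where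
  "down_rec S 0 acc = acc"
| "down_rec S (Suc n) acc = down_rec S n (S acc n)"

text \<open>Register \<open>d\<close> holds the counter, \<open>Suc d\<close> the accumulator, and
  \<open>Suc (Suc d)\<close> receives the value of the step before it is moved to the
  accumulator.\<close>

lemma rc_down_rec:
  assumes N: "register_computable N" and Z: "register_computable Z"
    and S: "register_computable (\<lambda>v. S (v 0) (v 1) (\<lambda>i. v (Suc (Suc i))))"
  shows "register_computable (\<lambda>v. down_rec (\<lambda>acc n. S acc n v) (N v) (Z v))"
proof (rule register_computableI)
  fix a :: "nat \<Rightarrow> nat" and d assume a: "\<forall>i. a i < d"
  obtain C1 f1 where 1: "transforms C1 f1" "\<And>\<sigma>. f1 \<sigma> d = N (\<sigma> \<circ> a)"
      "\<And>\<sigma> x. x < d \<Longrightarrow> f1 \<sigma> x = \<sigma> x"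
    using N a by (rule register_computableE) (rule that)
  have "\<forall>i. a i < Suc d"
    using a less_SucI by blast
  with Z obtain C2 f2 where 2: "transforms C2 f2" "\<And>\<sigma>. f2 \<sigma> (Suc d) = Z (\<sigma> \<circ> a)"
      "\<And>\<sigma> x. x < Suc d \<Longrightarrow> f2 \<sigma> x = \<sigma> x"
    by (rule register_computableE) (rule that)
  define b where "b = case_nat (Suc d) (case_nat d a)"
  have "\<forall>i. b i < Suc (Suc d)"
    using a by (auto simp: b_def less_SucI split: nat.splits)
  with S obtain C3 f3 where 3: "transforms C3 f3"
      "\<And>\<sigma>. f3 \<sigma> (Suc (Suc d)) = S ((\<sigma> \<circ> b) 0) ((\<sigma> \<circ> b) 1) (\<lambda>i. (\<sigma> \<circ> b) (Suc (Suc i)))"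
      "\<And>\<sigma> x. x < Suc (Suc d) \<Longrightarrow> f3 \<sigma> x = \<sigma> x"
    by (rule register_computableE) (rule that)
  define f where "f \<sigma> = (f3 \<sigma>)(Suc d := f3 \<sigma> (Suc (Suc d)), Suc (Suc d) := 0)" for \<sigma>
  define C where "C = Seq C3 (move (Suc (Suc d)) (Suc d))"
  have C: "transforms C f"
    using transforms_Seq[OF 3(1) transforms_move[of "Suc (Suc d)" "Suc d"]]
    by (simp add: C_def f_def[abs_def])
  have f_low: "f \<sigma> x = \<sigma> x" if "x < Suc d" for \<sigma> x
    using that 3(3) by (simp add: f_def)
  have f_acc: "f \<sigma> (Suc d) = S (\<sigma> (Suc d)) (\<sigma> d) (\<sigma> \<circ> a)" for \<sigma>
    using 3(2) by (simp add: f_def b_def comp_def)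
  \<comment> \<open>The effect of the loop on the whole state, scratch registers included; only
    \<open>G_low\<close> and \<open>G_acc\<close> are needed of it.\<close>
  define G where "G n = rec_nat (\<lambda>\<sigma>. \<sigma>) (\<lambda>n g \<sigma>. g (f (\<sigma>(d := n)))) n" for n
  have G: "G 0 \<sigma> = \<sigma>" "G (Suc n) \<sigma> = G n (f (\<sigma>(d := n)))" for n \<sigma>
    by (simp_all add: G_def)
  have loop: "transforms (WhileReg d (Seq (Dec d) C)) (\<lambda>\<sigma>. G (\<sigma> d) \<sigma>)"
    by (rule transforms_loop[OF C]) (auto simp: f_low G)
  have G_low: "x < d \<Longrightarrow> G n \<sigma> x = \<sigma> x" for n \<sigma> x
    by (induction n arbitrary: \<sigma>) (simp_all add: G f_low)
  have G_acc: "G n \<sigma> (Suc d) = down_rec (\<lambda>acc n. S acc n (\<sigma> \<circ> a)) n (\<sigma> (Suc d))" for n \<sigma>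
  proof (induction n arbitrary: \<sigma>)
    case (Suc n)
    have "a x \<noteq> d" "a x < Suc d" for x
      using a[THEN spec, of x] by simp_all
    then have "f (\<sigma>(d := n)) \<circ> a = \<sigma> \<circ> a" "\<sigma>(d := n) \<circ> a = \<sigma> \<circ> a"
      by (auto simp: fun_eq_iff f_low)
    then show ?case
      by (simp only: G Suc.IH f_acc down_rec.simps fun_upd_same)
         (simp add: comp_def)
  qed (simp add: G)
  have "f2 (f1 \<sigma>) \<circ> a = \<sigma> \<circ> a" "f1 \<sigma> \<circ> a = \<sigma> \<circ> a" for \<sigma>
    using a[THEN spec] by (auto simp: fun_eq_iff 1(3) 2(3) less_SucI)
  note eqs = this
  note T = transforms_Seq[OF 1(1) transforms_Seq[OF 2(1)
        transforms_Seq[OF loop transforms_move[of "Suc d" d]]]]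
  show "\<exists>C f. transforms C f \<and>
      (\<forall>\<sigma>. f \<sigma> d = down_rec (\<lambda>acc n. S acc n (\<sigma> \<circ> a)) (N (\<sigma> \<circ> a)) (Z (\<sigma> \<circ> a)) \<and>
           (\<forall>x<d. f \<sigma> x = \<sigma> x))"
    by (rule exI, rule exI, rule conjI, rule T) (auto simp: 1 2 G_low G_acc eqs)
qed

lemma rc_rename_Suc: "register_computable F \<Longrightarrow> register_computable (\<lambda>v. F (\<lambda>i. v (Suc i)))"
  by (rule rc_rename)

lemma rc_add [rc_intros]:
  assumes "register_computable F" "register_computable G"
  shows "register_computable (\<lambda>v. F v + G v)"
proof -
  have "down_rec (\<lambda>acc _. Suc acc) n m = n + m" for n m
    by (induction n arbitrary: m) auto
  then show ?thesis
    using rc_down_rec[OF assms, of "\<lambda>acc _ _. Suc acc"] rc_Suc[OF rc_proj] by simp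
qed

lemma rc_sum [rc_intros]:
  assumes N: "register_computable N" and F: "register_computable (\<lambda>v. F (v 0) (\<lambda>i. v (Suc i)))"
  shows "register_computable (\<lambda>v. \<Sum>i<N v. F i v)"
proof -
  have "down_rec (\<lambda>acc i. acc + F i v) n m = m + (\<Sum>i<n. F i v)" for n m v
    by (induction n arbitrary: m) auto
  moreover have "register_computable (\<lambda>v. v 0 + F (v 1) (\<lambda>i. v (Suc (Suc i))))"
    using rc_rename_Suc[OF F] by (intro rc_add rc_proj) simp
  ultimately show ?thesis
    using rc_down_rec[OF N rc_zero, of "\<lambda>acc i v. acc + F i v"] by simp
qed

lemma rc_mult [rc_intros]:
  assumes "register_computable F" "register_computable G"
  shows "register_computable (\<lambda>v. F v * G v)"
  using rc_sum[OF assms(1) rc_rename_Suc[OF assms(2)]] by simp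

lemma rc_power2 [rc_intros]:
  assumes "register_computable F"
  shows "register_computable (\<lambda>v. 2 ^ F v)"
proof -
  have "down_rec (\<lambda>acc _. acc + acc) n m = m * 2 ^ n" for n m
    by (induction n arbitrary: m) auto
  then show ?thesis
    using rc_down_rec[OF assms rc_const[of 1], of "\<lambda>acc _ _. acc + acc"] rc_add[OF rc_proj rc_proj]
    by simp
qed

definition register_decidable :: "((nat \<Rightarrow> nat) \<Rightarrow> bool) \<Rightarrow> bool" where
  "register_decidable P \<longleftrightarrow> register_computable (\<lambda>v. of_bool (P v))"

lemma rc_is_zero: 
  assumes "register_computable F"
  shows "register_decidable (\<lambda>v. F v = 0)"
proof -
  have "down_rec (\<lambda>_ _. 0) n 1 = of_bool (n = 0)" for n
    by (cases n) (auto simp: down_rec_def intro: nat_induct)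
  then show ?thesis
    unfolding register_decidable_def
    using rc_down_rec[OF assms rc_const[of 1], of "\<lambda>_ _ _. 0"] rc_const by simp
qed

lemma rd_not [rc_intros]:
  assumes "register_decidable P"
  shows "register_decidable (\<lambda>v. \<not> P v)"
  using rc_is_zero[OF assms[unfolded register_decidable_def]] by simp

lemma rd_conj [rc_intros]:
  assumes "register_decidable P" "register_decidable Q"
  shows "register_decidable (\<lambda>v. P v \<and> Q v)"
  using rc_mult[OF assms[unfolded register_decidable_def]]
  by (simp add: register_decidable_def of_bool_conj)

lemma rd_disj [rc_intros]:
  assumes "register_decidable P" "register_decidable Q"
  shows "register_decidable (\<lambda>v. P v \<or> Q v)"
  using rd_not[OF rd_conj[OF assms[THEN rd_not]]] by simp

lemma rc_pred:
  assumes "register_computable F"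
  shows "register_computable (\<lambda>v. F v - 1)"
proof -
  have "(\<Sum>i<n. of_bool (i \<noteq> 0)) = n - 1" for n :: nat
    by (induction n) auto
  moreover have "register_computable (\<lambda>v. of_bool (v 0 \<noteq> 0))"
    using rd_not[OF rc_is_zero[OF rc_proj]] by (simp add: register_decidable_def)
  ultimately show ?thesis
    using rc_sum[OF assms, of "\<lambda>i v. of_bool (i \<noteq> 0)"] by simp
qed

lemma rc_diff [rc_intros]:
  assumes "register_computable F" "register_computable G"
  shows "register_computable (\<lambda>v. F v - G v)"
proof -
  have "down_rec (\<lambda>acc _. acc - 1) n m = m - n" for n m
    by (induction n arbitrary: m) auto
  then show ?thesis
    using rc_down_rec[OF assms(2,1), of "\<lambda>acc _ _. acc - 1"] rc_pred[OF rc_proj] by simp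
qed

lemma rd_le [rc_intros]:
  assumes "register_computable F" "register_computable G"
  shows "register_decidable (\<lambda>v. F v \<le> G v)"
  using rc_is_zero[OF rc_diff[OF assms]] by simp

lemma rd_less [rc_intros]:
  assumes "register_computable F" "register_computable G"
  shows "register_decidable (\<lambda>v. F v < G v)"
  using rd_not[OF rd_le[OF assms(2,1)]] by (simp add: not_le)

lemma rd_eq [rc_intros]:
  assumes "register_computable F" "register_computable G"
  shows "register_decidable (\<lambda>v. F v = G v)"
  using rd_conj[OF rd_le[OF assms] rd_le[OF assms(2,1)]] by (simp add: eq_iff)

lemma rd_iff [rc_intros]:
  assumes "register_decidable P" "register_decidable Q"
  shows "register_decidable (\<lambda>v. P v \<longleftrightarrow> Q v)"
  using rd_eq[OF assms[unfolded register_decidable_def]] by (simp add: of_bool_eq_iff)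

lemma rd_ex [rc_intros]:
  assumes "register_computable N" "register_decidable (\<lambda>v. P (v 0) (\<lambda>i. v (Suc i)))"
  shows "register_decidable (\<lambda>v. \<exists>i<N v. P i v)"
proof -
  have "((\<Sum>i<N v. of_bool (P i v)) \<noteq> (0::nat)) \<longleftrightarrow> (\<exists>i<N v. P i v)" for v
    by (auto simp: sum_eq_0_iff)
  then show ?thesis
    using rd_not[OF rc_is_zero[OF rc_sum[OF assms(1), of "\<lambda>i v. of_bool (P i v)"]]]
      assms(2) by (simp add: register_decidable_def)
qed

lemma rd_all [rc_intros]:
  assumes "register_computable N" "register_decidable (\<lambda>v. P (v 0) (\<lambda>i. v (Suc i)))"
  shows "register_decidable (\<lambda>v. \<forall>i<N v. P i v)"
  using rd_not[OF rd_ex[OF assms(1), of "\<lambda>i v. \<not> P i v"]] rd_not[OF assms(2)] by simp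

lemma rc_of_bool [rc_intros]:
  "register_decidable P \<Longrightarrow> register_computable (\<lambda>v. of_bool (P v))"
  by (simp add: register_decidable_def)

lemma rc_if [rc_intros]:
  assumes "register_decidable P" "register_computable F" "register_computable G"
  shows "register_computable (\<lambda>v. if P v then F v else G v)"
proof -
  have "register_computable (\<lambda>v. of_bool (P v) * F v + of_bool (\<not> P v) * G v)"
    using assms by (intro rc_intros)
  moreover have "of_bool P * x + of_bool (\<not> P) * y = (if P then x else y)" for P and x y :: nat
    by simp
  ultimately show ?thesis
    by simp
qed

text \<open>The quotient counts the \<open>q\<close> with \<open>y * Suc q \<le> x\<close>; the
  condition \<open>0 < y\<close> yields the value 0 for division by 0.\<close>

lemma rc_div [rc_intros]:
  assumes "register_computable F" "register_computable G"
  shows "register_computable (\<lambda>v. F v div G v)"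
proof -
  have "(\<Sum>q<x. of_bool (0 < y \<and> y * Suc q \<le> x)) = x div y" for x y :: nat
  proof (cases "0 < y")
    case True
    have "{..<x} \<inter> {q. y * Suc q \<le> x} = {..<x div y}"
    proof (intro set_eqI iffI)
      fix q assume "q \<in> {..<x} \<inter> {q. y * Suc q \<le> x}"
      then show "q \<in> {..<x div y}"
        using True less_eq_div_iff_mult_less_eq[of y "Suc q" x]
        by (simp add: Suc_le_eq mult.commute)
    next
      fix q assume q: "q \<in> {..<x div y}"
      then have "Suc q * y \<le> x"
        using True less_eq_div_iff_mult_less_eq[of y "Suc q" x] by (simp add: Suc_le_eq)
      then show "q \<in> {..<x} \<inter> {q. y * Suc q \<le> x}"
        using q less_le_trans[OF _ div_le_dividend, of q x y] by (simp add: mult.commute)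
    qed
    then show ?thesis
      using True by (simp add: sum.If_cases of_bool_def)
  qed simp
  moreover have "register_computable (\<lambda>v. \<Sum>q<F v. of_bool (0 < G v \<and> G v * Suc q \<le> F v))"
    using assms by (intro rc_intros rc_rename_Suc)
  ultimately show ?thesis
    by simp
qed

lemma rc_mod [rc_intros]:
  assumes "register_computable F" "register_computable G"
  shows "register_computable (\<lambda>v. F v mod G v)"
proof -
  have "register_computable (\<lambda>v. F v - G v * (F v div G v))"
    using assms by (intro rc_intros)
  then show ?thesis
    by (simp add: minus_mult_div_eq_mod)
qed

section \<open>Transducers\<close>

lemma written_mono: "t \<le> t' \<Longrightarrow> \<exists>u. written (run M I t') = written (run M I t) @ u"
proof (induction t' rule: dec_induct)
  case (step t')
  have "\<exists>u. written (step M I c) = written c @ u" for c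
    unfolding step_def by (cases "M ! pc c") auto
  then show ?case
    using step.IH by (metis append.assoc comp_apply funpow.simps(2) run_def)
qed simp

text \<open>Output only grows, so unboundedly long snapshots determine it at all times: a longer
  snapshot must occur later. This removes step counting from what follows.\<close>

lemma writes_if_unbounded:
  assumes W: "\<And>n. \<exists>t. written (run M I t) = W n" and q: "\<And>n. prefix_of (W n) q"
    and long: "\<And>k. \<exists>n. k \<le> length (W n)"
  shows "writes M I q"
  unfolding writes_def
proof (intro conjI allI)
  fix k
  show "\<exists>t. k \<le> length (written (run M I t))"
    using W long by metis
next
  fix t
  obtain n where n: "Suc (length (written (run M I t))) \<le> length (W n)"
    using long by blast
  obtain t' where t': "written (run M I t') = W n"
    using W by blast
  have "t \<le> t'"
  proof (rule ccontr)
    assume "\<not> t \<le> t'"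
    then obtain u where "written (run M I t) = W n @ u"
      using written_mono[of t' t M I] t' by auto
    then show False
      using n by simp
  qed
  then obtain u where "W n = written (run M I t) @ u"
    using written_mono[of t t' M I] t' by auto
  then have "prefix_of (written (run M I t)) q"
    using q[of n] by (simp add: prefix_of_append)
  then show "written (run M I t) = map q [0..<length (written (run M I t))]"
    by (simp add: prefix_of_def)
qed

lemma unary_shift_blocks:
  "unary s ((\<Sum>j<n. s j) + n + i) = unary (\<lambda>k. s (n + k)) i"
proof (induction n arbitrary: s)
  case (Suc n)
  have "(\<Sum>j<Suc n. s j) + Suc n + i = Suc (s 0) + ((\<Sum>j<n. s (Suc j)) + n + i)"
    by (simp add: sum.lessThan_Suc_shift del: sum.lessThan_Suc)
  then show ?case
    by (simp only: unary_shift Suc.IH) simp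
qed simp

lemma unary_block:
  "i < s n \<Longrightarrow> unary s ((\<Sum>j<n. s j) + n + i)"
  "\<not> unary s ((\<Sum>j<n. s j) + n + s n)"
  using unary_less[of i "\<lambda>k. s (n + k)"] unary_first_zero[of "\<lambda>k. s (n + k)"]
  by (simp_all add: unary_shift_blocks)

definition count_until :: "nat \<Rightarrow> nat \<Rightarrow> symbol \<Rightarrow> cmd" where
  "count_until r i a = WhileIn i a (Seq (Inc r) (Adv i))"

lemma big_count_until:
  assumes "\<And>j. j < k \<Longrightarrow> I i (p i + j) \<noteq> a" "I i (p i + k) = a"
  shows "big I (count_until r i a) (\<sigma>, p, w) (\<sigma>(r := \<sigma> r + k), p(i := p i + k), w)"
  using assms
proof (induction k arbitrary: \<sigma> p)
  case 0
  then show ?case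
    by (auto simp: count_until_def intro: big_WhileIn_done)
next
  case (Suc k)
  have "I i (p i) \<noteq> a"
    using Suc.prems(1)[of 0] by simp
  moreover have "big I (Seq (Inc r) (Adv i)) (\<sigma>, p, w)
      (\<sigma>(r := Suc (\<sigma> r)), p(i := Suc (p i)), w)"
    by (blast intro: big.intros)
  moreover have "big I (count_until r i a) (\<sigma>(r := Suc (\<sigma> r)), p(i := Suc (p i)), w)
      (\<sigma>(r := \<sigma> r + Suc k), p(i := p i + Suc k), w)"
    using Suc.IH[of "p(i := Suc (p i))" "\<sigma>(r := Suc (\<sigma> r))"] Suc.prems(1)[of "Suc _"]
      Suc.prems(2) by (simp del: fun_upd_apply add: fun_upd_same)
  ultimately show ?case
    unfolding count_until_def by (rule big_WhileIn_step)
qed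

definition emit_unary :: "nat \<Rightarrow> cmd" where
  "emit_unary r = Seq (WhileReg r (Seq (Dec r) (Emit True))) (Emit False)"

lemma big_emit_unary:
  "\<sigma> r = n \<Longrightarrow> big I (emit_unary r) (\<sigma>, p, w) (\<sigma>(r := 0), p, w @ replicate n True @ [False])"
proof -
  have "\<sigma> r = n \<Longrightarrow>
      big I (WhileReg r (Seq (Dec r) (Emit True))) (\<sigma>, p, w) (\<sigma>(r := 0), p, w @ replicate n True)"
  proof (induction n arbitrary: \<sigma> w)
    case 0
    then show ?case
      using big_WhileReg_done[of \<sigma> r I _ p w] by (simp add: fun_upd_idem)
  next
    case (Suc n)
    have "big I (Seq (Dec r) (Emit True)) (\<sigma>, p, w) (\<sigma>(r := n), p, w @ [True])"
      using Suc.prems by (blast intro: big.intros)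
    moreover have "big I (WhileReg r (Seq (Dec r) (Emit True))) (\<sigma>(r := n), p, w @ [True])
        (\<sigma>(r := 0), p, w @ replicate (Suc n) True)"
      using Suc.IH[of "\<sigma>(r := n)" "w @ [True]"] by (simp del: fun_upd_apply add: fun_upd_same)
    moreover have "\<sigma> r \<noteq> 0"
      using Suc.prems by simp
    ultimately show ?case
      by (rule big_WhileReg_step[rotated])
  qed
  then show "\<sigma> r = n \<Longrightarrow> ?thesis"
    unfolding emit_unary_def using big_Emit[of I False "\<sigma>(r := 0)" p "w @ replicate n True"]
    by (auto intro: big_Seq)
qed

text \<open>The shift by one reserves 0 for a round without output.\<close>

fun output_word :: "nat \<Rightarrow> bool list" where
  "output_word 0 = []"
| "output_word (Suc n) = replicate n True @ [False]"

lemma big_emit_optional: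
  "big I (WhileReg r (Seq (Dec r) (emit_unary r))) (\<sigma>, p, w) (\<sigma>(r := 0), p, w @ output_word (\<sigma> r))"
proof (cases "\<sigma> r")
  case 0
  then show ?thesis
    using big_WhileReg_done[of \<sigma> r I _ p w] by (simp add: fun_upd_idem)
next
  case (Suc n)
  have "big I (Seq (Dec r) (emit_unary r)) (\<sigma>, p, w) (\<sigma>(r := 0), p, w @ output_word (\<sigma> r))"
    using big_Seq[OF big_Dec[of \<sigma> r n, OF Suc] big_emit_unary[of "\<sigma>(r := n)" r n]] Suc by simp
  then show ?thesis
    using Suc by (rule_tac big_WhileReg_step) (auto intro: big_WhileReg_done)
qed

text \<open>\<open>N\<close> is the length of the advice. The start values 1 and 0 encode the unit
  interval for the bisection below.\<close>

primrec transducer_state ::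
  "(nat \<Rightarrow> nat \<Rightarrow> nat \<Rightarrow> nat \<Rightarrow> nat) \<Rightarrow> (nat \<Rightarrow> nat \<Rightarrow> nat \<Rightarrow> nat \<Rightarrow> nat) \<Rightarrow> (nat \<Rightarrow> nat) \<Rightarrow> nat \<Rightarrow>
   nat \<Rightarrow> nat \<times> nat" where
  "transducer_state F G s N 0 = (1, 0)"
| "transducer_state F G s N (Suc i) =
     (case transducer_state F G s N i of (a, b) \<Rightarrow> (F (s i) N a b, G (s i) N a b))"

primrec transducer_output ::
  "(nat \<Rightarrow> nat \<Rightarrow> nat \<Rightarrow> nat \<Rightarrow> nat) \<Rightarrow> (nat \<Rightarrow> nat \<Rightarrow> nat \<Rightarrow> nat \<Rightarrow> nat) \<Rightarrow>
   (nat \<Rightarrow> nat \<Rightarrow> nat \<Rightarrow> nat \<Rightarrow> nat) \<Rightarrow> (nat \<Rightarrow> nat) \<Rightarrow> nat \<Rightarrow> nat \<Rightarrow> bool list" where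
  "transducer_output F G H s N 0 = []"
| "transducer_output F G H s N (Suc i) = transducer_output F G H s N i @
     (case transducer_state F G s N i of (a, b) \<Rightarrow> output_word (H (s i) N a b))"

lemma transducer_machine:
  assumes "register_computable (\<lambda>v. F (v 0) (v 1) (v 2) (v 3))"
    "register_computable (\<lambda>v. G (v 0) (v 1) (v 2) (v 3))"
    "register_computable (\<lambda>v. H (v 0) (v 1) (v 2) (v 3))"
  shows "\<exists>M. \<forall>s w n. \<exists>t.
    written (run M (inputs (unary s) w) t) = transducer_output F G H s (length w) n"
proof -
  \<comment> \<open>Every address must lie below the result register, although only four arguments
    matter; register 3 stands in for the others.\<close>
  define a where "a = (\<lambda>i. min i (3::nat))"
  have a: "a 0 = 0" "a 1 = 1" "a (Suc 0) = Suc 0" "a 2 = 2" "a 3 = 3"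
    by (simp_all add: a_def)
  have "\<forall>i. a i < 4" "\<forall>i. a i < 5" "\<forall>i. a i < 6"
    by (simp_all add: a_def min_def)
  note bounds = this
  obtain CH h where H: "transforms CH h" "\<And>\<sigma>. h \<sigma> 4 = H (\<sigma> 0) (\<sigma> 1) (\<sigma> 2) (\<sigma> 3)"
      "\<And>\<sigma> x. x < 4 \<Longrightarrow> h \<sigma> x = \<sigma> x"
    using register_computableE[OF assms(3) bounds(1)] a by (auto simp: comp_def)
  obtain CF f where F: "transforms CF f" "\<And>\<sigma>. f \<sigma> 5 = F (\<sigma> 0) (\<sigma> 1) (\<sigma> 2) (\<sigma> 3)"
      "\<And>\<sigma> x. x < 5 \<Longrightarrow> f \<sigma> x = \<sigma> x"
    using register_computableE[OF assms(1) bounds(2)] a by (auto simp: comp_def)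
  obtain CG g where G: "transforms CG g" "\<And>\<sigma>. g \<sigma> 6 = G (\<sigma> 0) (\<sigma> 1) (\<sigma> 2) (\<sigma> 3)"
      "\<And>\<sigma> x. x < 6 \<Longrightarrow> g \<sigma> x = \<sigma> x"
    using register_computableE[OF assms(2) bounds(3)] a by (auto simp: comp_def)
  \<comment> \<open>The new state is parked in registers 5 and 6, so that all three functions see
    the old one.\<close>
  define compute where
    "compute = Seq CH (Seq CF (Seq CG (Seq (move 5 2) (move 6 3))))"
  define k where "k \<sigma> = (g (f (h \<sigma>)))(2 := g (f (h \<sigma>)) 5, 5 := 0, 3 := g (f (h \<sigma>)) 6, 6 := 0)" for \<sigma>
  have "transforms compute k"
    using transforms_Seq[OF H(1) transforms_Seq[OF F(1) transforms_Seq[OF G(1)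
          transforms_Seq[OF transforms_move[of 5 2] transforms_move[of 6 3]]]]]
    by (simp add: compute_def k_def[abs_def])
  moreover have k: "k \<sigma> 1 = \<sigma> 1" "k \<sigma> 2 = F (\<sigma> 0) (\<sigma> 1) (\<sigma> 2) (\<sigma> 3)"
    "k \<sigma> 3 = G (\<sigma> 0) (\<sigma> 1) (\<sigma> 2) (\<sigma> 3)" "k \<sigma> 4 = H (\<sigma> 0) (\<sigma> 1) (\<sigma> 2) (\<sigma> 3)" for \<sigma>
    by (simp_all add: k_def F G H)
  define read where "read = Seq (clear 0) (Seq (count_until 0 0 (Some False)) (Adv 0))"
  define body where
    "body = Seq read (Seq compute (WhileReg 4 (Seq (Dec 4) (emit_unary 4))))"
  define init where "init = Seq (count_until 1 1 None) (Inc 2)"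
  obtain M where M: "\<And>I S n. (\<And>n. I 0 n \<noteq> None) \<Longrightarrow> big I init ((\<lambda>_. 0), (\<lambda>_. 0), []) (S 0) \<Longrightarrow>
     (\<And>n. big I body (S n) (S (Suc n))) \<Longrightarrow> \<exists>t. written (run M I t) = snd (snd (S n))"
    using loop_machine[of init body] by metis
  have "\<exists>t. written (run M (inputs (unary s) w) t) = transducer_output F G H s (length w) n"
    for s w n
  proof -
    define I where "I = inputs (unary s) w"
    define N where "N = length w"
    define Q where "Q n st \<longleftrightarrow> (case st of (\<sigma>, p, u) \<Rightarrow> \<sigma> 1 = N \<and>
        (\<sigma> 2, \<sigma> 3) = transducer_state F G s N n \<and> p 0 = (\<Sum>j<n. s j) + n \<and>
        u = transducer_output F G H s N n)" for n and st :: state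
    let ?\<sigma> = "\<lambda>_. 0 :: nat"
    define s0 :: state where "s0 = (?\<sigma>(1 := N, 2 := 1), (\<lambda>_. 0)(1 := N), [])"
    have "big I (count_until 1 1 None) (?\<sigma>, \<lambda>_. 0, []) (?\<sigma>(1 := ?\<sigma> 1 + N), (\<lambda>_. 0)(1 := 0 + N), [])"
      by (rule big_count_until) (simp_all add: I_def N_def inputs_def)
    then have init: "big I init (?\<sigma>, \<lambda>_. 0, []) s0"
      unfolding init_def s0_def by (rule big_Seq) (use big_Inc[of I 2 "(\<lambda>_. 0)(1 := N)"] in simp)
    have "\<exists>st'. big I body st st' \<and> Q (Suc n) st'" if "Q n st" for n st
    proof -
      obtain \<sigma> p u where st: "st = (\<sigma>, p, u)"
        by (rule prod_cases3)
      have Q: "\<sigma> 1 = N" "(\<sigma> 2, \<sigma> 3) = transducer_state F G s N n" "p 0 = (\<Sum>j<n. s j) + n"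
          "u = transducer_output F G H s N n"
        using that by (simp_all add: Q_def st)
      have "big I (count_until 0 0 (Some False)) (\<sigma>(0 := 0), p, u)
          (\<sigma>(0 := 0, 0 := (\<sigma>(0 := 0)) 0 + s n), p(0 := p 0 + s n), u)"
        by (rule big_count_until) (simp_all add: Q(3) I_def inputs_def unary_block)
      moreover have "big I (Adv 0) (\<sigma>(0 := s n), p(0 := p 0 + s n), u)
          (\<sigma>(0 := s n), p(0 := Suc (p 0 + s n)), u)"
        using big_Adv[of I 0 _ "p(0 := p 0 + s n)"] by simp
      moreover have "big I (clear 0) (\<sigma>, p, u) (\<sigma>(0 := 0), p, u)"
        using transforms_clear by (simp add: transforms_def)
      ultimately have "big I read st (\<sigma>(0 := s n), p(0 := Suc (p 0 + s n)), u)"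
        unfolding read_def st by (auto intro: big_Seq)
      moreover have "big I compute (\<sigma>(0 := s n), p(0 := Suc (p 0 + s n)), u)
          (k (\<sigma>(0 := s n)), p(0 := Suc (p 0 + s n)), u)"
        using \<open>transforms compute k\<close> by (simp add: transforms_def)
      ultimately have "big I body st ((k (\<sigma>(0 := s n)))(4 := 0), p(0 := Suc (p 0 + s n)),
          u @ output_word (k (\<sigma>(0 := s n)) 4))"
        unfolding body_def using big_emit_optional by (blast intro: big_Seq)
      moreover have "Q (Suc n) ((k (\<sigma>(0 := s n)))(4 := 0), p(0 := Suc (p 0 + s n)),
          u @ output_word (k (\<sigma>(0 := s n)) 4))"
        using Q by (simp add: Q_def k k(1)[unfolded One_nat_def] Q(2)[symmetric])
      ultimately show ?thesis
        by blast
    qed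
    moreover have "Q 0 s0"
      by (simp add: Q_def s0_def)
    ultimately obtain S where S: "S 0 = s0" "\<And>n. Q n (S n)" "\<And>n. big I body (S n) (S (Suc n))"
      using dependent_nat_choice[of "\<lambda>n st. Q n st \<and> (n = 0 \<longrightarrow> st = s0)" "\<lambda>n. big I body"]
      by (metis nat.distinct(1))
    have "I 0 i \<noteq> None" for i
      by (simp add: I_def inputs_def)
    then have "\<exists>t. written (run M I t) = snd (snd (S n))"
      using M[of I S n] init S by simp
    then show ?thesis
      using S(2)[of n] unfolding Q_def I_def N_def by (auto split: prod.splits)
  qed
  then show ?thesis
    by blast
qed

section \<open>Certificates for the sign of a value\<close>

definition letter :: "nat \<Rightarrow> nat \<Rightarrow> bool" where
  "letter U j \<longleftrightarrow> (U div 2 ^ j) mod 2 = 1"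

definition word_length :: "nat \<Rightarrow> nat \<Rightarrow> bool" where
  "word_length U L \<longleftrightarrow> 2 ^ L \<le> U \<and> U < 2 * 2 ^ L"

lemma word_num_surj: "0 < U \<Longrightarrow> \<exists>u. word_num u = U"
proof (induction U rule: less_induct)
  case (less U)
  show ?case
  proof (cases "U = 1")
    case True
    then show ?thesis
      by (intro exI[of _ "[]"]) simp
  next
    case False
    then have "0 < U div 2" "U div 2 < U"
      using less.prems by auto
    then obtain u where "word_num u = U div 2"
      using less.IH by blast
    then have "word_num ((U mod 2 = 1) # u) = U"
      by (simp add: of_bool_def) presburger
    then show ?thesis
      by blast
  qed
qed

lemma letter_word_num: "j < length u \<Longrightarrow> letter (word_num u) j = u ! j"
proof (induction u arbitrary: j)
  case (Cons b u)
  show ?case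
  proof (cases j)
    case 0
    then show ?thesis
      by (simp add: letter_def of_bool_def)
  next
    case (Suc i)
    have "(of_bool b + 2 * word_num u) div 2 = word_num u"
      by (simp add: of_bool_def)
    then show ?thesis
      using Cons Suc by (simp add: letter_def div_mult2_eq)
  qed
qed simp

lemma word_length_word_num: "word_length (word_num u) L \<longleftrightarrow> L = length u"
proof -
  have *: "word_length (word_num u) (length u)"
  proof (induction u)
    case (Cons b u)
    then show ?case
      by (cases b) (auto simp: word_length_def)
  qed (simp add: word_length_def)
  have "L = L'" if "word_length U L" "word_length U L'" for U L L'
  proof (rule ccontr)
    assume "L \<noteq> L'"
    then consider "Suc L \<le> L'" | "Suc L' \<le> L"
      by linarith
    then show False
    proof cases
      case 1
      then have "2 * 2 ^ L \<le> (2::nat) ^ L'"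
        using power_increasing[OF 1, of "2::nat"] by simp
      then show False
        using that by (simp add: word_length_def)
    next
      case 2
      then have "2 * 2 ^ L' \<le> (2::nat) ^ L"
        using power_increasing[OF 2, of "2::nat"] by simp
      then show False
        using that by (simp add: word_length_def)
    qed
  qed
  then show ?thesis
    using * by blast
qed

lemma length_less_word_num: "length u < word_num u"
  using word_length_word_num[of u "length u"] less_exp[of "length u"]
  unfolding word_length_def by linarith

text \<open>In the constant name the zeros recur with period \<open>Suc n\<close>, so its prefixes
  can be recognized arithmetically.\<close>

lemma unary_const: "unary (\<lambda>_. n) j \<longleftrightarrow> Suc j mod Suc n \<noteq> 0"
proof -
  have "j \<in> range (\<lambda>k. (\<Sum>i\<le>k. n) + k) \<longleftrightarrow> (\<exists>k. Suc j = Suc n * Suc k)"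
    by (auto simp: image_iff algebra_simps)
  also have "\<dots> \<longleftrightarrow> Suc n dvd Suc j"
    unfolding dvd_def by (metis mult_0_right nat.distinct(1) not0_implies_Suc)
  finally show ?thesis
    by (simp add: unary_def dvd_eq_mod_eq_0)
qed

text \<open>The bound on \<open>L\<close> excludes no word, as a word is shorter than its number;
  bounded quantifiers make the predicate register-decidable.\<close>

definition const_prefix :: "nat \<Rightarrow> nat \<Rightarrow> bool" where
  "const_prefix U n \<longleftrightarrow>
     (\<exists>L<U. word_length U L \<and> (\<forall>j<L. letter U j \<longleftrightarrow> Suc j mod Suc n \<noteq> 0))"

lemma const_prefix_iff: "const_prefix (word_num u) n \<longleftrightarrow> prefix_of u (unary (\<lambda>_. n))"
  using length_less_word_num[of u]
  by (auto simp: const_prefix_def word_length_word_num prefix_of_iff unary_const letter_word_num)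

text \<open>In the library's numbering, \<open>\<alpha>\<close> is the number of an integer of absolute value
  \<open>Suc \<alpha> div 2\<close> that is negative if \<open>\<alpha>\<close> is odd, so \<open>z\<close> is 0 for a positive and 1 for a negative
  quotient; \<open>k\<close> is the precision of the approximation with number \<open>c\<close>.\<close>

definition decisive :: "nat \<Rightarrow> nat \<Rightarrow> nat \<Rightarrow> bool" where
  "decisive c k z \<longleftrightarrow> (\<exists>\<alpha><Suc c. \<exists>\<beta><Suc c. prod_encode (\<alpha>, \<beta>) = c \<and> 0 < \<beta> \<and>
     Suc \<beta> div 2 < Suc \<alpha> div 2 * 2 ^ k \<and> (\<alpha> + \<beta>) mod 2 = z)"

lemma int_decode_alt: "int_decode n = (if even n then int (Suc n div 2) else - int (Suc n div 2))"
  by (auto simp: int_decode_def sum_decode_def elim!: evenE oddE)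

lemma rat_num_eq: "rat_num (prod_encode (\<alpha>, \<beta>)) = real_of_int (int_decode \<alpha>) / real_of_int (int_decode \<beta>)"
  by (cases "int_decode \<beta> = 0")
     (simp_all add: rat_num_def nat_to_rat_surj_def rat_number_collapse of_rat_rat)

text \<open>Cross-multiplication by the absolute values, the sign being the parity of
  \<open>\<alpha> + \<beta>\<close>. Denominator 0 is never decisive, in accordance with the
  quotient 0.\<close>

lemma decisive_iff:
  "decisive c k 0 \<longleftrightarrow> 1 / 2 ^ k < rat_num c" "decisive c k (Suc 0) \<longleftrightarrow> rat_num c < - (1 / 2 ^ k)"
proof -
  obtain \<alpha> \<beta> where c: "c = prod_encode (\<alpha>, \<beta>)"
    by (metis prod_decode_inverse surj_pair)
  have dec: "decisive c k z \<longleftrightarrow>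
      0 < \<beta> \<and> Suc \<beta> div 2 < Suc \<alpha> div 2 * 2 ^ k \<and> (\<alpha> + \<beta>) mod 2 = z" for z
    unfolding decisive_def c using le_prod_encode_1 le_prod_encode_2
    by (auto simp: less_Suc_eq_le)
  define p q where "p = real (Suc \<alpha> div 2)" and "q = real (Suc \<beta> div 2)"
  have pq: "0 \<le> p" "0 \<le> q" "0 < \<beta> \<longleftrightarrow> 0 < q"
    by (auto simp: p_def q_def)
  have size: "Suc \<beta> div 2 < Suc \<alpha> div 2 * 2 ^ k \<longleftrightarrow> q < p * 2 ^ k"
    by (simp only: p_def q_def of_nat_less_iff[symmetric, where 'a = real] of_nat_mult of_nat_power
        of_nat_numeral)
  have rat: "rat_num c = (if even (\<alpha> + \<beta>) then p / q else - (p / q))"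
  proof -
    have "real_of_int (int_decode \<alpha>) = (if even \<alpha> then p else - p)"
      "real_of_int (int_decode \<beta>) = (if even \<beta> then q else - q)"
      unfolding int_decode_alt p_def q_def by (simp_all split: if_splits)
    then show ?thesis
      unfolding c rat_num_eq by simp
  qed
  have big: "0 < q \<and> q < p * 2 ^ k \<longleftrightarrow> 1 / 2 ^ k < p / q"
    using pq by (cases "q = 0") (auto simp: field_simps)
  have dec': "decisive c k z \<longleftrightarrow> 1 / 2 ^ k < p / q \<and> (\<alpha> + \<beta>) mod 2 = z" for z
    unfolding dec size pq(3) using big by blast
  have nonneg: "\<not> 1 / 2 ^ k < - (p / q)"
  proof -
    have "0 \<le> p / q" "(0::real) < 1 / 2 ^ k"
      using pq by simp_all
    then show ?thesis
      by linarith
  qed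
  show "decisive c k 0 \<longleftrightarrow> 1 / 2 ^ k < rat_num c"
    unfolding dec' rat using nonneg by (cases "even (\<alpha> + \<beta>)") (simp_all add: mod_2_eq_odd)
  show "decisive c k (Suc 0) \<longleftrightarrow> rat_num c < - (1 / 2 ^ k)"
    unfolding dec' rat using nonneg
    by (cases "even (\<alpha> + \<beta>)") (simp_all add: mod_2_eq_odd neg_less_iff_less minus_less_iff)
qed

definition block_at :: "(nat \<Rightarrow> bool) \<Rightarrow> nat \<Rightarrow> nat \<Rightarrow> bool" where
  "block_at r b c \<longleftrightarrow> \<not> r (b + c) \<and> (\<forall>i<c. r (b + i)) \<and> (b = 0 \<or> \<not> r (b - 1))"

text \<open>The index of a block is the number of zeros before it, so its precision can be read off
  without decoding the earlier blocks.\<close>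

lemma block_at_unary: "block_at (unary t) b c \<Longrightarrow> c = t (\<Sum>i<b. of_bool (\<not> unary t i))"
proof (induction b arbitrary: t rule: less_induct)
  case (less b)
  show ?case
  proof (cases "b = 0")
    case True
    then show ?thesis
      using less.prems unary_less[of _ t] unary_first_zero[of t]
      by (auto simp: block_at_def) (metis nat_neq_iff)
  next
    case False
    then have "\<not> unary t (b - 1)"
      using less.prems by (simp add: block_at_def)
    then have "t 0 \<le> b - 1"
      using unary_less[of "b - 1" t] by (meson not_le)
    then have "\<exists>b'. b = Suc (t 0) + b'"
      using False by (intro exI[of _ "b - Suc (t 0)"]) simp
    then obtain b' where b': "b = Suc (t 0) + b'"
      by blast
    define t' where "t' = (\<lambda>k. t (Suc k))"
    have t': "unary t (Suc (t 0) + i) = unary t' i" for i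
      unfolding t'_def by (rule unary_shift)
    have "block_at (unary t') b' c"
      unfolding block_at_def
    proof (intro conjI allI impI)
      show "\<not> unary t' (b' + c)"
        using less.prems t'[of "b' + c"] by (simp add: block_at_def b' add.assoc)
      show "unary t' (b' + i)" if "i < c" for i
        using less.prems t'[of "b' + i"] that by (simp add: block_at_def b' add.assoc)
      show "b' = 0 \<or> \<not> unary t' (b' - 1)"
        using less.prems t'[of "b' - 1"] by (cases b') (auto simp: block_at_def b')
    qed
    then have "c = t' (\<Sum>i<b'. of_bool (\<not> unary t' i))"
      using less.IH[of b'] b' by simp
    moreover have "(\<Sum>i<b. of_bool (\<not> unary t i)) = Suc (\<Sum>i<b'. of_bool (\<not> unary t' i))"
    proof -
      have "(\<Sum>i<Suc (t 0) + b'. of_bool (\<not> unary t i)) =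
          (\<Sum>i<Suc (t 0). of_bool (\<not> unary t i)) + (\<Sum>i<b'. of_bool (\<not> unary t (Suc (t 0) + i)) :: nat)"
        by (induction b') simp_all
      also have "(\<Sum>i<Suc (t 0). of_bool (\<not> unary t i)) = (1::nat)"
        using unary_first_zero[of t] unary_less[of _ t] by simp
      finally show ?thesis
        by (simp only: b' t')
    qed
    ultimately show ?thesis
      by (simp add: t'_def)
  qed
qed

lemma block_exists:
  "\<exists>b. block_at (unary t) b (t k) \<and> (\<Sum>i<b. of_bool (\<not> unary t i)) = k"
proof (intro exI conjI)
  let ?b = "\<lambda>k. (\<Sum>j<k. t j) + k"
  show "block_at (unary t) (?b k) (t k)"
    unfolding block_at_def
  proof (intro conjI allI impI)
    show "?b k = 0 \<or> \<not> unary t (?b k - 1)"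
      using unary_block(2)[of t "k - 1"] by (cases k) (auto simp: algebra_simps)
  qed (simp_all add: unary_block)
  show "(\<Sum>i<?b k. of_bool (\<not> unary t i)) = k"
  proof (induction k)
    case (Suc k)
    have "(\<Sum>i<?b k + l. of_bool (\<not> unary t i)) = k" if "l \<le> t k" for l
      using that Suc by (induction l) (simp_all add: unary_block Suc_le_eq)
    from this[of "t k"] have "(\<Sum>i<Suc (?b k + t k). of_bool (\<not> unary t i)) = Suc k"
      using unary_block(2)[of t k] by simp
    moreover have "?b (Suc k) = Suc (?b k + t k)"
      by simp
    ultimately show ?case
      by (simp only:)
  qed simp
qed

definition sign_certificate :: "nat \<Rightarrow> nat \<Rightarrow> bool" where
  "sign_certificate V z \<longleftrightarrow> (\<exists>L<V. word_length V L \<and> (\<exists>b<L. \<exists>c<L. b + c < L \<and>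
     \<not> letter V (b + c) \<and> (\<forall>i<c. letter V (b + i)) \<and> (b = 0 \<or> \<not> letter V (b - 1)) \<and>
     decisive c (\<Sum>i<b. of_bool (\<not> letter V i)) z))"

lemma sign_certificate_iff:
  assumes "prefix_of v r"
  shows "sign_certificate (word_num v) z \<longleftrightarrow> (\<exists>b c. b + c < length v \<and> block_at r b c \<and>
    decisive c (\<Sum>i<b. of_bool (\<not> r i)) z)"
proof -
  have l: "letter (word_num v) j = r j" if "j < length v" for j
    using letter_word_num[OF that] assms that by (simp add: prefix_of_iff)
  have "(\<Sum>i<b. of_bool (\<not> letter (word_num v) i)) = (\<Sum>i<b. of_bool (\<not> r i) :: nat)"
    if "b < length v" for b
    using that by (intro sum.cong) (simp_all add: l)
  then have "(b < length v \<and> c < length v \<and> b + c < length v \<and> \<not> letter (word_num v) (b + c) \<and>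
      (\<forall>i<c. letter (word_num v) (b + i)) \<and> (b = 0 \<or> \<not> letter (word_num v) (b - 1)) \<and>
      decisive c (\<Sum>i<b. of_bool (\<not> letter (word_num v) i)) z) \<longleftrightarrow>
    (b + c < length v \<and> block_at r b c \<and> decisive c (\<Sum>i<b. of_bool (\<not> r i)) z)" for b c
    by (auto simp: block_at_def l simp del: sum_of_bool_eq)
  note eq = this
  have "sign_certificate (word_num v) z \<longleftrightarrow> (\<exists>b c. b < length v \<and> c < length v \<and>
      b + c < length v \<and> \<not> letter (word_num v) (b + c) \<and>
      (\<forall>i<c. letter (word_num v) (b + i)) \<and> (b = 0 \<or> \<not> letter (word_num v) (b - 1)) \<and>
      decisive c (\<Sum>i<b. of_bool (\<not> letter (word_num v) i)) z)"
    unfolding sign_certificate_def word_length_word_num using length_less_word_num[of v] by blast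
  then show ?thesis
    by (simp only: eq)
qed

definition certificate :: "nat \<Rightarrow> nat \<Rightarrow> nat \<Rightarrow> bool" where
  "certificate x n z \<longleftrightarrow> (\<exists>U<Suc x. \<exists>V<Suc x. prod_encode (U, V) = x \<and>
     const_prefix U n \<and> sign_certificate V z)"

text \<open>\<open>n\<close> is the number of a rational argument, \<open>t\<close> encodes its value under the function named by
  \<open>s\<close>. Every certificate occurs infinitely often because the listed output words are arbitrarily
  long.\<close>

context
  fixes s t :: "nat \<Rightarrow> nat" and n :: nat
  assumes eta: "eta (unary s) (unary (\<lambda>_. n)) (unary t)"
begin

lemma certificate_sound: "certificate (s i) n z \<Longrightarrow> \<exists>k. decisive (t k) k z"
proof -
  assume "certificate (s i) n z"
  then obtain U V where UV: "prod_encode (U, V) = s i" "const_prefix U n" "sign_certificate V z"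
    unfolding certificate_def by blast
  then have "0 < U" "0 < V"
    by (auto simp: const_prefix_def sign_certificate_def)
  then obtain u v where uv: "U = word_num u" "V = word_num v"
    using word_num_surj by metis
  have "listed s u v"
    using UV(1) uv by (metis listed_def)
  moreover have "prefix_of u (unary (\<lambda>_. n))"
    using UV(2) uv const_prefix_iff by simp
  ultimately have "prefix_of v (unary t)"
    using eta by (auto simp: eta_def)
  then show ?thesis
    using UV(3) uv sign_certificate_iff[of v "unary t"] block_at_unary by blast
qed

lemma certificate_complete:
  assumes "decisive (t k) k z"
  shows "\<exists>i\<ge>i0. certificate (s i) n z"
proof -
  obtain b where b: "block_at (unary t) b (t k)" "(\<Sum>i<b. of_bool (\<not> unary t i)) = k"
    using block_exists by blast
  \<comment> \<open>Beyond the block itself, the length exceeds all entries before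
    \<open>i0\<close>. Since the number of a word and the code of a pair are at least as large, the
    entry found cannot be one of those.\<close>
  obtain u v where uv: "listed s u v" "prefix_of u (unary (\<lambda>_. n))"
      "b + t k + 1 + (\<Sum>i<i0. s i) \<le> length v"
    using eta unfolding eta_def by (metis unary_inject)
  then have v: "prefix_of v (unary t)"
    using eta by (auto simp: eta_def)
  obtain i where i: "s i = prod_encode (word_num u, word_num v)"
    using uv(1) by (auto simp: listed_def)
  have "word_num v \<le> s i" "word_num u \<le> s i"
    unfolding i by (rule le_prod_encode_2, rule le_prod_encode_1)
  moreover have "\<not> i < i0"
  proof
    assume "i < i0"
    then have "s i \<le> (\<Sum>i<i0. s i)"
      by (intro member_le_sum) auto
    then show False
      using uv(3) length_less_word_num[of v] \<open>word_num v \<le> s i\<close> by linarith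
  qed
  moreover have "sign_certificate (word_num v) z"
    unfolding sign_certificate_iff[OF v]
    using b assms uv(3) by (intro exI[of _ b] exI[of _ "t k"]) auto
  ultimately show ?thesis
    using uv(2) i by (intro exI[of _ i]) (auto simp: certificate_def const_prefix_iff less_Suc_eq_le)
qed

end

lemma rc_prod_encode [rc_intros]:
  assumes "register_computable F" "register_computable G"
  shows "register_computable (\<lambda>v. prod_encode (F v, G v))"
proof -
  have "register_computable (\<lambda>v. ((F v + G v) * Suc (F v + G v)) div 2 + F v)"
    using assms by (intro rc_intros)
  then show ?thesis
    by (simp add: prod_encode_def triangle_def)
qed

lemma rd_decisive [rc_intros]:
  assumes "register_computable C" "register_computable K" "register_computable Z"
  shows "register_decidable (\<lambda>v. decisive (C v) (K v) (Z v))"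
  unfolding decisive_def using assms by (intro rc_intros rc_rename_Suc)

lemma rd_letter [rc_intros]:
  assumes "register_computable U" "register_computable J"
  shows "register_decidable (\<lambda>v. letter (U v) (J v))"
  unfolding letter_def using assms by (intro rc_intros)

lemma rd_word_length [rc_intros]:
  assumes "register_computable U" "register_computable L"
  shows "register_decidable (\<lambda>v. word_length (U v) (L v))"
  unfolding word_length_def using assms by (intro rc_intros)

lemma rd_const_prefix [rc_intros]:
  assumes "register_computable U" "register_computable N"
  shows "register_decidable (\<lambda>v. const_prefix (U v) (N v))"
  unfolding const_prefix_def using assms by (intro rc_intros rc_rename_Suc)

lemma rd_sign_certificate [rc_intros]:
  assumes "register_computable V" "register_computable Z"
  shows "register_decidable (\<lambda>v. sign_certificate (V v) (Z v))"
  unfolding sign_certificate_def using assms by (intro rc_intros rc_rename_Suc)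

lemma rd_certificate [rc_intros]:
  assumes "register_computable X" "register_computable N" "register_computable Z"
  shows "register_decidable (\<lambda>v. certificate (X v) (N v) (Z v))"
  unfolding certificate_def using assms by (intro rc_intros rc_rename_Suc)

section \<open>Bisection\<close>

lemma certificate_sign:
  assumes f: "rho_to_rho (unary s) f" and x: "rat_num n \<in> {0..1}" and nz: "f (rat_num n) \<noteq> 0"
  shows "certificate (s i) n 0 \<Longrightarrow> 0 < f (rat_num n)"
    and "certificate (s i) n (Suc 0) \<Longrightarrow> f (rat_num n) < 0"
    and "\<exists>i\<ge>i0. certificate (s i) n 0 \<or> certificate (s i) n (Suc 0)"
proof -
  \<comment> \<open>A rational number approximates itself with every precision; this is the name
    that \<open>const_prefix\<close> tests for.\<close>
  have "rho (unary (\<lambda>_. n)) (rat_num n)"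
    by (simp add: rho_unary)
  then obtain r where r: "eta (unary s) (unary (\<lambda>_. n)) r" "rho r (f (rat_num n))"
    using f x unfolding rho_to_rho_def by blast
  then obtain t where t: "r = unary t" "\<And>k. \<bar>f (rat_num n) - rat_num (t k)\<bar> \<le> 1 / 2 ^ k"
    unfolding rho_def by blast
  have eta: "eta (unary s) (unary (\<lambda>_. n)) (unary t)"
    using r(1) t(1) by simp
  show "0 < f (rat_num n)" if c: "certificate (s i) n 0"
  proof -
    obtain k where "decisive (t k) k 0"
      using certificate_sound[OF eta c] by blast
    then show ?thesis
      using t(2)[of k] by (simp add: decisive_iff)
  qed
  show "f (rat_num n) < 0" if c: "certificate (s i) n (Suc 0)"
  proof -
    obtain k where "decisive (t k) k (Suc 0)"
      using certificate_sound[OF eta c] by blast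
    then show ?thesis
      using t(2)[of k] by (simp add: decisive_iff)
  qed
  \<comment> \<open>Half of the value suffices: the approximation loses at most
    \<open>1 / 2 ^ k\<close> and must keep more than \<open>1 / 2 ^ k\<close>.\<close>
  obtain k where "(1 / 2) ^ k < \<bar>f (rat_num n)\<bar> / 2"
    using real_arch_pow_inv[of "\<bar>f (rat_num n)\<bar> / 2" "1 / 2"] nz by auto
  then have "1 / 2 ^ k < rat_num (t k) \<or> rat_num (t k) < - (1 / 2 ^ k)"
    using t(2)[of k] by (auto simp: power_one_over abs_if split: if_splits)
  then have "decisive (t k) k 0 \<or> decisive (t k) k (Suc 0)"
    by (simp add: decisive_iff)
  then show "\<exists>i\<ge>i0. certificate (s i) n 0 \<or> certificate (s i) n (Suc 0)"
    using certificate_complete[OF eta] by blast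
qed

text \<open>Even numbers code the nonnegative integers in \<open>int_decode\<close>, hence the
  doubling.\<close>

definition rat_code :: "nat \<Rightarrow> nat \<Rightarrow> nat" where
  "rat_code m P = prod_encode (2 * m, 2 * P)"

lemma rat_num_rat_code: "rat_num (rat_code m P) = real m / real P"
  by (simp add: rat_code_def rat_num_eq int_decode_alt)

text \<open>\<open>(2 * m + 1) / (2 * P)\<close> is the midpoint of the current interval.\<close>

definition found :: "nat \<Rightarrow> nat \<Rightarrow> nat \<Rightarrow> bool" where
  "found x P m \<longleftrightarrow> certificate x (rat_code (Suc (2 * m)) (2 * P)) 0 \<or>
     certificate x (rat_code (Suc (2 * m)) (2 * P)) (Suc 0)"

text \<open>The current interval is \<open>[m / P, (m + 1) / P]\<close>. Positive \<open>N\<close> is advice to output the number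
  \<open>N - 1\<close> forever.\<close>

definition bisect_P :: "nat \<Rightarrow> nat \<Rightarrow> nat \<Rightarrow> nat \<Rightarrow> nat" where
  "bisect_P x N P m = (if found x P m then 2 * P else P)"

definition bisect_m :: "nat \<Rightarrow> nat \<Rightarrow> nat \<Rightarrow> nat \<Rightarrow> nat" where
  "bisect_m x N P m = (if certificate x (rat_code (Suc (2 * m)) (2 * P)) (Suc 0) then Suc (2 * m)
     else if found x P m then 2 * m else m)"

definition bisect_out :: "nat \<Rightarrow> nat \<Rightarrow> nat \<Rightarrow> nat \<Rightarrow> nat" where
  "bisect_out x N P m =
     (if N = 0 then if found x P m then Suc (rat_code m P) else 0 else N)"

lemma bisect_computable:
  "register_computable (\<lambda>v. bisect_P (v 0) (v 1) (v 2) (v 3))"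
  "register_computable (\<lambda>v. bisect_m (v 0) (v 1) (v 2) (v 3))"
  "register_computable (\<lambda>v. bisect_out (v 0) (v 1) (v 2) (v 3))"
  unfolding bisect_P_def bisect_m_def bisect_out_def found_def rat_code_def
  by (intro rc_intros)+

abbreviation "bisect_state \<equiv> transducer_state bisect_P bisect_m"
abbreviation "bisect_output \<equiv> transducer_output bisect_P bisect_m bisect_out"

text \<open>The positive advice number is passed on unchanged, because \<open>output_word\<close>
  undoes the same shift by one.\<close>

lemma bisect_output_const:
  "bisect_output s (Suc c) n = enc (map (\<lambda>_. c) [0..<n])"
proof (induction n)
  case (Suc n)
  have "bisect_out x (Suc c) P m = Suc c" for x P m
    by (simp add: bisect_out_def)
  then show ?case
    using Suc by (simp add: enc_append split: prod.splits)
qed simp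

text \<open>The ideal bisection, which consults the signs themselves. The transducer follows the
  same path but may wait before each halving.\<close>

primrec left :: "(real \<Rightarrow> real) \<Rightarrow> nat \<Rightarrow> nat" where
  "left f 0 = 0"
| "left f (Suc k) = (if f (real (Suc (2 * left f k)) / 2 ^ Suc k) < 0
     then Suc (2 * left f k) else 2 * left f k)"

context
  fixes f :: "real \<Rightarrow> real"
  assumes f: "f \<in> mdom Intermed" and no_rat_zero: "\<And>n. rat_num n \<notin> Intermed f"
begin

lemma f_props: "f \<in> mspace C01" "f 0 = -1" "f 1 = 1"
  "x \<in> Intermed f \<longleftrightarrow> x \<in> {0..1} \<and> f x = 0"
  using f by (auto simp: mdom_def Intermed_def split: if_splits)

lemma left_less: "left f k < 2 ^ k"
  by (induction k) auto

lemma mid_in_unit: "real (Suc (2 * left f k)) / 2 ^ Suc k \<in> {0..1}"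
proof -
  have "Suc (2 * left f k) \<le> 2 ^ Suc k"
    using left_less[of k] by simp
  then have "real (Suc (2 * left f k)) \<le> 2 ^ Suc k"
    by (metis of_nat_le_iff of_nat_numeral of_nat_power)
  then show ?thesis
    by (simp add: field_simps)
qed

lemma f_mid_nonzero: "f (real (Suc (2 * left f k)) / 2 ^ Suc k) \<noteq> 0"
  using no_rat_zero[of "rat_code (Suc (2 * left f k)) (2 ^ Suc k)"] mid_in_unit[of k]
  by (simp add: f_props(4) rat_num_rat_code)

lemma left_sign: "f (real (left f k) / 2 ^ k) < 0 \<and> 0 < f ((real (left f k) + 1) / 2 ^ k)"
proof (induction k)
  case (Suc k)
  have "real (2 * left f k) / 2 ^ Suc k = real (left f k) / 2 ^ k"
    "(real (Suc (2 * left f k)) + 1) / 2 ^ Suc k = (real (left f k) + 1) / 2 ^ k"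
    "(real (2 * left f k) + 1) / 2 ^ Suc k = real (Suc (2 * left f k)) / 2 ^ Suc k"
    by (simp_all add: field_simps)
  then show ?case
    using Suc f_mid_nonzero[of k] by (simp only: left.simps split: if_split)
      (metis linorder_neqE_linordered_idom)
qed (simp add: f_props)

text \<open>Interval number \<open>k\<close> has length \<open>1 / 2 ^ k\<close>, so its left
  endpoint is already an approximation as good as block \<open>k\<close> of a name requires.\<close>

lemma left_converges: "\<exists>y\<in>Intermed f. \<forall>k. \<bar>y - real (left f k) / 2 ^ k\<bar> \<le> 1 / 2 ^ k"
proof -
  define a where "a k = real (left f k) / 2 ^ k" for k
  define b where "b k = (real (left f k) + 1) / 2 ^ k" for k
  have step: "2 * left f k \<le> left f (Suc k)" "left f (Suc k) \<le> Suc (2 * left f k)" for k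
    by auto
  have "a k \<le> a (Suc k)" for k
  proof -
    have "2 * real (left f k) \<le> real (left f (Suc k))"
      using step(1)[of k] by linarith
    then show ?thesis
      by (simp add: a_def field_simps del: left.simps)
  qed
  moreover have "b (Suc k) \<le> b k" for k
  proof -
    have "real (left f (Suc k)) \<le> real (Suc (2 * left f k))"
      using step(2)[of k] by (rule of_nat_mono)
    then have "(real (left f (Suc k)) + 1) / 2 \<le> real (left f k) + 1"
      by (simp del: left.simps)
    then have "(real (left f (Suc k)) + 1) / 2 / 2 ^ k \<le> (real (left f k) + 1) / 2 ^ k"
      by (rule divide_right_mono) simp
    then show ?thesis
      by (simp add: b_def del: left.simps)
  qed
  moreover have ab: "b k = a k + 1 / 2 ^ k" for k
    by (simp add: a_def b_def add_divide_distrib)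
  moreover have "(\<lambda>k. a k - b k) \<longlonglongrightarrow> 0"
    using tendsto_minus[OF LIMSEQ_power_zero[of "1 / 2 :: real"]] by (simp add: ab power_one_over)
  ultimately obtain y where y: "\<And>k. a k \<le> y" "a \<longlonglongrightarrow> y" "\<And>k. y \<le> b k" "b \<longlonglongrightarrow> y"
    using nested_sequence_unique[of a b] by auto
  have a01: "a k \<in> {0..1}" and b01: "b k \<in> {0..1}" for k
  proof -
    have "Suc (left f k) \<le> 2 ^ k"
      using left_less[of k] by simp
    then have "real (Suc (left f k)) \<le> real (2 ^ k)"
      by (rule of_nat_mono)
    then have "real (left f k) + 1 \<le> 2 ^ k"
      by simp
    then show "a k \<in> {0..1}" "b k \<in> {0..1}"
      unfolding a_def b_def using left_less[of k] by (simp_all add: divide_le_eq less_imp_le)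
  qed
  have y01: "y \<in> {0..1}"
    using y(1)[of 0] y(3)[of 0] a01[of 0] b01[of 0] by auto
  have cont: "continuous_on {0..1} f"
    using f_props(1) by (simp add: mspace_C01)
  have "(\<lambda>k. f (a k)) \<longlonglongrightarrow> f y" "(\<lambda>k. f (b k)) \<longlonglongrightarrow> f y"
    by (rule continuous_on_tendsto_compose[OF cont]; use y a01 b01 y01 in simp)+
  moreover have "f (a k) \<le> 0" "0 \<le> f (b k)" for k
    using left_sign[of k] by (simp_all add: a_def b_def)
  ultimately have "f y = 0"
    by (meson LIMSEQ_le_const LIMSEQ_le_const2 order_antisym)
  moreover have "\<bar>y - a k\<bar> \<le> 1 / 2 ^ k" for k
    using y(1,3)[of k] ab[of k] by simp
  ultimately show ?thesis
    using y01 by (intro bexI[of _ y]) (simp_all add: f_props(4) a_def)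
qed

context
  fixes s :: "nat \<Rightarrow> nat"
  assumes s: "rho_to_rho (unary s) f"
begin

lemma mid_code: "rat_num (rat_code (Suc (2 * left f k)) (2 * 2 ^ k)) = real (Suc (2 * left f k)) / 2 ^ Suc k"
  by (simp add: rat_num_rat_code)

lemma certificate_mid:
  "certificate (s i) (rat_code (Suc (2 * left f k)) (2 * 2 ^ k)) 0 \<Longrightarrow>
     0 < f (real (Suc (2 * left f k)) / 2 ^ Suc k)"
  "certificate (s i) (rat_code (Suc (2 * left f k)) (2 * 2 ^ k)) (Suc 0) \<Longrightarrow>
     f (real (Suc (2 * left f k)) / 2 ^ Suc k) < 0"
  "\<exists>i\<ge>i0. found (s i) (2 ^ k) (left f k)"
  using certificate_sign[OF s, of "rat_code (Suc (2 * left f k)) (2 * 2 ^ k)"] mid_in_unit[of k]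
    f_mid_nonzero[of k] unfolding mid_code found_def by blast+

lemma bisect_step:
  assumes "found (s i) (2 ^ k) (left f k)"
  shows "bisect_P (s i) N (2 ^ k) (left f k) = 2 ^ Suc k"
    "bisect_m (s i) N (2 ^ k) (left f k) = left f (Suc k)"
    "bisect_out (s i) 0 (2 ^ k) (left f k) = Suc (rat_code (left f k) (2 ^ k))"
proof -
  show "bisect_m (s i) N (2 ^ k) (left f k) = left f (Suc k)"
  proof -
    have "certificate (s i) (rat_code (Suc (2 * left f k)) (2 * 2 ^ k)) (Suc 0) \<longleftrightarrow>
        f (real (Suc (2 * left f k)) / 2 ^ Suc k) < 0"
      using assms certificate_mid(1,2)[of i k] unfolding found_def by (meson less_asym)
    then show ?thesis
      by (simp only: bisect_m_def left.simps assms if_True)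
  qed
qed (use assms in \<open>simp_all add: bisect_P_def bisect_out_def\<close>)

lemma bisect_idle:
  assumes "\<not> found (s i) (2 ^ k) (left f k)"
  shows "bisect_P (s i) N (2 ^ k) (left f k) = 2 ^ k"
    "bisect_m (s i) N (2 ^ k) (left f k) = left f k"
    "bisect_out (s i) 0 (2 ^ k) (left f k) = 0"
  using assms by (auto simp: bisect_P_def bisect_m_def bisect_out_def found_def)

text \<open>The number \<open>k\<close> of completed halvings is existential because it depends on
  when certificates turn up in the name.\<close>

lemma bisect_invariant:
  "\<exists>k. bisect_state s 0 i = (2 ^ k, left f k) \<and>
     bisect_output s 0 i = enc (map (\<lambda>j. rat_code (left f j) (2 ^ j)) [0..<k])"
proof (induction i)
  case 0
  then show ?case
    by (intro exI[of _ 0]) simp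
next
  case (Suc i)
  then obtain k where k: "bisect_state s 0 i = (2 ^ k, left f k)"
    "bisect_output s 0 i = enc (map (\<lambda>j. rat_code (left f j) (2 ^ j)) [0..<k])"
    by blast
  show ?case
  proof (cases "found (s i) (2 ^ k) (left f k)")
    case True
    then show ?thesis
      using k by (intro exI[of _ "Suc k"])
        (simp add: bisect_step enc_append del: left.simps power_Suc)
  next
    case False
    then show ?thesis
      using k by (intro exI[of _ k]) (simp add: bisect_idle)
  qed
qed

text \<open>A certificate for stage \<open>K\<close> still occurs after the stage is reached. When
  it is read, either the machine is still at this stage and advances, or another certificate has
  moved it on before.\<close>

lemma bisect_progress: "\<exists>i k. K \<le> k \<and> bisect_state s 0 i = (2 ^ k, left f k)"
proof (induction K)
  case 0
  then show ?case
    using bisect_invariant[of 0] by blast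
next
  case (Suc K)
  then obtain i0 k0 where k0: "K \<le> k0" "bisect_state s 0 i0 = (2 ^ k0, left f k0)"
    by blast
  show ?case
  proof (cases "K = k0")
    case True
    obtain i where i: "i0 \<le> i" "found (s i) (2 ^ K) (left f K)"
      using certificate_mid(3) by blast
    obtain k where k: "bisect_state s 0 i = (2 ^ k, left f k)"
      using bisect_invariant[of i] by (elim exE conjE) (rule that)
    have "fst (bisect_state s 0 j) \<le> fst (bisect_state s 0 (Suc j))" for j
      by (simp add: bisect_P_def case_prod_unfold)
    then have "fst (bisect_state s 0 i0) \<le> fst (bisect_state s 0 i)"
      using lift_Suc_mono_le[of "\<lambda>j. fst (bisect_state s 0 j)"] i(1) by simp
    then have "K \<le> k"
      using k k0(2) True by simp
    show ?thesis
    proof (cases "K = k")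
      case True
      then have "bisect_state s 0 (Suc i) = (2 ^ Suc K, left f (Suc K))"
        using k i(2) by (simp add: bisect_step del: left.simps power_Suc)
      then show ?thesis
        by blast
    next
      case False
      then show ?thesis
        using \<open>K \<le> k\<close> k Suc_leI by (metis le_neq_implies_less)
    qed
  next
    case False
    then show ?thesis
      using k0 by (metis Suc_leI le_neq_implies_less)
  qed
qed

end

end

text \<open>\<open>LEAST\<close> makes the advice a function of \<open>f\<close>, so the classes are
  disjoint. Only the length of the word carries information; the empty word is reserved for
  functions without rational zeros.\<close>

definition advice :: "(real \<Rightarrow> real) \<Rightarrow> bool list" where
  "advice f = (if \<exists>n. rat_num n \<in> Intermed f
     then replicate (Suc (LEAST n. rat_num n \<in> Intermed f)) True else [])"

lemma Intermed_machine:
  "\<exists>M. \<forall>f\<in>mdom Intermed. \<forall>p. rho_to_rho p f \<longrightarrow>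
     (\<exists>q. writes M (inputs p (advice f)) q \<and> (\<exists>b\<in>Intermed f. rho q b))"
proof -
  obtain M where M: "\<And>s w n. \<exists>t. written (run M (inputs (unary s) w) t) = bisect_output s (length w) n"
    using transducer_machine[OF bisect_computable] by blast
  have "\<exists>q. writes M (inputs p (advice f)) q \<and> (\<exists>b\<in>Intermed f. rho q b)"
    if f: "f \<in> mdom Intermed" and p: "rho_to_rho p f" for f p
  proof -
    obtain n where "rat_num n = 0"
      using rat_num_surj by fastforce
    then have "rho (unary (\<lambda>_. n)) 0"
      by (simp add: rho_unary)
    then obtain r where "eta p (unary (\<lambda>_. n)) r"
      using p unfolding rho_to_rho_def by fastforce
    then obtain s where s: "p = unary s"
      unfolding eta_def by blast
    show ?thesis
    proof (cases "\<exists>n. rat_num n \<in> Intermed f")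
      case True
      define c where "c = (LEAST n. rat_num n \<in> Intermed f)"
      have c: "rat_num c \<in> Intermed f" "length (advice f) = Suc c"
        using True LeastI_ex[of "\<lambda>n. rat_num n \<in> Intermed f"] by (simp_all add: advice_def c_def)
      have "writes M (inputs p (advice f)) (unary (\<lambda>_. c))"
      proof (rule writes_if_unbounded)
        show "\<exists>t. written (run M (inputs p (advice f)) t) = enc (map (\<lambda>_. c) [0..<n])" for n
          using M[of s "advice f" n] by (simp add: s c(2) bisect_output_const)
        show "prefix_of (enc (map (\<lambda>_. c) [0..<n])) (unary (\<lambda>_. c))" for n
          by (rule prefix_of_enc_map)
        show "\<exists>n. k \<le> length (enc (map (\<lambda>_. c) [0..<n]))" for k
          using length_le_length_enc[of "map (\<lambda>_. c) [0..<k]"] by auto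
      qed
      moreover have "rho (unary (\<lambda>_. c)) (rat_num c)"
        by (simp add: rho_unary)
      ultimately show ?thesis
        using c(1) by blast
    next
      case False
      then have nz: "\<And>n. rat_num n \<notin> Intermed f"
        by blast
      define z where "z = (\<lambda>j. rat_code (left f j) (2 ^ j))"
      have len: "length (advice f) = 0"
        using False by (simp add: advice_def)
      have inv: "\<exists>k. bisect_state s 0 i = (2 ^ k, left f k) \<and>
          bisect_output s 0 i = enc (map z [0..<k])" for i
        using bisect_invariant[OF f nz p[unfolded s], of i] unfolding z_def .
      have "writes M (inputs p (advice f)) (unary z)"
      proof (rule writes_if_unbounded)
        show "\<exists>t. written (run M (inputs p (advice f)) t) = bisect_output s 0 n" for n
          using M[of s "advice f" n] by (simp add: s len)
        show "prefix_of (bisect_output s 0 n) (unary z)" for n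
          using inv[of n] prefix_of_enc_map by auto
        show "\<exists>n. K \<le> length (bisect_output s 0 n)" for K
        proof -
          obtain i k where ik: "K \<le> k" "bisect_state s 0 i = (2 ^ k, left f k)"
            using bisect_progress[OF f nz p[unfolded s]] by blast
          then have "bisect_output s 0 i = enc (map z [0..<k])"
            using inv[of i] by auto
          then show ?thesis
            using length_le_length_enc[of "map z [0..<k]"] ik(1) by (intro exI[of _ i]) simp
        qed
      qed
      moreover have "\<exists>b\<in>Intermed f. rho (unary z) b"
        using left_converges[OF f nz] by (simp add: rho_unary z_def rat_num_rat_code)
      ultimately show ?thesis
        by blast
    qed
  qed
  then show ?thesis
    by blast
qed

definition advice_class :: "bool list \<Rightarrow> (real \<Rightarrow> real) set" where
  "advice_class w = {f \<in> mdom Intermed. advice f = w}"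

lemma partition_advice: "partition_on (mdom Intermed) (advice_class ` advice ` mdom Intermed)"
  by (rule partition_onI) (auto simp: advice_class_def disjnt_def)

lemma Intermed_computable_with_advice:
  "\<exists>\<delta>. notation_of (advice_class ` advice ` mdom Intermed) \<delta> \<and>
     computable_with_advice Intermed rho_to_rho rho \<delta>"
proof -
  \<comment> \<open>Words that are nobody's advice stay undefined, since their empty classes do not
    belong to the partition.\<close>
  define \<delta> where "\<delta> w = (if w \<in> advice ` mdom Intermed then Some (advice_class w) else None)" for w
  have "notation_of (advice_class ` advice ` mdom Intermed) \<delta>"
    unfolding notation_of_def ran_def \<delta>_def by (auto split: if_splits)
  moreover have "w = advice f" if "\<delta> w = Some D" "f \<in> D" for w D f
    using that by (auto simp: \<delta>_def advice_class_def split: if_splits)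
  then have "computable_with_advice Intermed rho_to_rho rho \<delta>"
    unfolding computable_with_advice_def using Intermed_machine by metis
  ultimately show ?thesis
    by blast
qed

text \<open>A notation is onto, so \<open>D\<close> has a word; with this word fixed on the second
  tape, the machine works on \<open>D\<close> from the name alone.\<close>

lemma mcontinuous_if_computable_with_advice:
  assumes "notation_of \<Delta> \<delta>" "computable_with_advice Intermed rho_to_rho rho \<delta>" "D \<in> \<Delta>"
  shows "mcontinuous (mtopology_of C01) euclidean (mrestrict Intermed D)"
proof -
  obtain w where w: "\<delta> w = Some D"
    using assms(1,3) by (auto simp: notation_of_def ran_def)
  obtain M where M: "\<forall>a\<in>mdom Intermed. \<forall>p w D. rho_to_rho p a \<and> \<delta> w = Some D \<and> a \<in> D \<longrightarrow>
      (\<exists>q. writes M (inputs p w) q \<and> (\<exists>b\<in>Intermed a. rho q b))"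
    using assms(2) unfolding computable_with_advice_def by blast
  show ?thesis
    by (rule mcontinuous_if_machine[where M = M and w = w]) (use M w in blast)
qed

section \<open>Cardinalities and the final statement\<close>

lemma least_cardinality_natLeq:
  assumes "\<Delta> \<in> \<D>" "countable \<Delta>" "\<And>\<Delta>. \<Delta> \<in> \<D> \<Longrightarrow> infinite \<Delta>"
  shows "least_cardinality \<D> natLeq"
proof -
  have low: "natLeq \<le>o |\<Delta>'|" if "\<Delta>' \<in> \<D>" for \<Delta>'
    using assms(3)[OF that] infinite_iff_natLeq_ordLeq by blast
  have "|\<Delta>| \<le>o |UNIV :: nat set|"
    using assms(2) card_of_ordLeq[of \<Delta> "UNIV :: nat set"] by (auto simp: countable_def)
  then have "|\<Delta>| \<le>o natLeq"
    using card_of_nat ordLeq_ordIso_trans by blast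
  then have "|\<Delta>| =o natLeq"
    using low[OF assms(1)] by (simp add: ordIso_iff_ordLeq)
  then show ?thesis
    unfolding least_cardinality_def using assms(1) low by blast
qed

theorem theorem5:
  shows "(C_c_eq Intermed rho_to_rho rho natLeq \<and>
          C_t_eq (mtopology_of C01) euclidean Intermed natLeq) \<and>
         \<not> (\<exists>d. wise_rep_continuous d psi_gt rho Select)"
proof (intro conjI)
  let ?\<Delta> = "advice_class ` advice ` mdom Intermed"
  have count: "countable ?\<Delta>"
    by simp
  \<comment> \<open>This implication is used twice: it carries the lower bound over to
    computability, and it makes the advice partition admissible for the topological
    complexity.\<close>
  have cont: "\<forall>D\<in>\<Delta>. mcontinuous (mtopology_of C01) euclidean (mrestrict Intermed D)"
    if "\<exists>\<delta>. notation_of \<Delta> \<delta> \<and> computable_with_advice Intermed rho_to_rho rho \<delta>" for \<Delta>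
    using that mcontinuous_if_computable_with_advice by blast
  show "C_c_eq Intermed rho_to_rho rho natLeq"
    unfolding C_c_eq_def
  proof (rule least_cardinality_natLeq[of ?\<Delta>])
    show "?\<Delta> \<in> {\<Delta>. partition_on (mdom Intermed) \<Delta> \<and> countable \<Delta> \<and>
        (\<exists>\<delta>. notation_of \<Delta> \<delta> \<and> computable_with_advice Intermed rho_to_rho rho \<delta>)}"
      using partition_advice count Intermed_computable_with_advice by blast
  qed (use count cont Intermed_no_finite_partition in blast)+
  show "C_t_eq (mtopology_of C01) euclidean Intermed natLeq"
    unfolding C_t_eq_def
  proof (rule least_cardinality_natLeq[of ?\<Delta>])
    show "?\<Delta> \<in> {\<Delta>. partition_on (mdom Intermed) \<Delta> \<and>
        (\<forall>D\<in>\<Delta>. mcontinuous (mtopology_of C01) euclidean (mrestrict Intermed D))}"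
      using partition_advice cont[OF Intermed_computable_with_advice] by blast
  qed (use count Intermed_no_finite_partition in blast)+
  show "\<not> (\<exists>d. wise_rep_continuous d psi_gt rho Select)"
    using Select_not_wise_continuous by blast
qed

end
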